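(* Let $\mathcal{T}=\mathcal{T}^{\bar 0}\oplus\mathcal{T}^{\bar 1}$ be the centerless topological $N=2$ superconformal algebra over $\mathbb{C}$, with Lie superbracket $\varphi=[\cdot,\cdot]$. Every Lie super-bialgebra structure on $\mathcal{T}$ is triangular coboundary. That is, for every linear map $\Delta:\mathcal{T}\to\mathcal{T}\otimes\mathcal{T}$ such that $(\mathcal{T},[\cdot,\cdot],\Delta)$ is a Lie super-bialgebra, there exists a ($\mathbb{Z}_2$-homogeneous) element $r\in\mathrm{Im}(1\otimes 1-\tau)\subset\mathcal{T}\otimes\mathcal{T}$ such that $\Delta=\Delta_r$ and $r$ satisfies the classical Yang-Baxter equation $c(r)=0$.
   Context: All vector spaces are over $\mathbb{C}$; $\mathbb{Z}_2=\{\bar 0,\bar 1\}$. For a super-vector space $\mathcal{T}=\mathcal{T}^{\bar 0}\oplus\mathcal{T}^{\bar 1}$ and a homogeneous element $x$, $[x]\in\mathbb{Z}_2$ denotes the parity of $x$; formulas involving parities are stated for homogeneous elements and extended linearly. The centerless topological $N=2$ superconformal algebra $\mathcal{T}$ is the Lie superalgebra with basis $\{L_n,H_n,G_n,Q_n \mid n\in\mathbb{Z}\}$, where $\mathcal{T}^{\bar 0}=\mathrm{Span}_{\mathbb{C}}\{L_n,H_n\mid n\in\mathbb{Z}\}$ and $\mathcal{T}^{\bar 1}=\mathrm{Span}_{\mathbb{C}}\{G_n,Q_n\mid n\in\mathbb{Z}\}$, and whose only non-vanishing brackets (up to super-skew-symmetry) are $$[L_m,L_n]=(m-n)L_{m+n},\quad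 [L_m,H_n]=-nH_{m+n},\quad [L_m,G_n]=(m-n)G_{m+n},\quad [L_m,Q_n]=-nQ_{m+n},$$ $$[H_m,G_n]=G_{m+n},\quad [H_m,Q_n]=-Q_{m+n},\quad [G_m,Q_n]=2L_{m+n}-2nH_{m+n}.$$ The super-twist map $\tau$ on $\mathcal{T}\otimes\mathcal{T}$ is $\tau(x_1\otimes x_2)=(-1)^{[x_1][x_2]}x_2\otimes x_1$, and the super-cyclic map $\xi$ on $\mathcal{T}\otimes\mathcal{T}\otimes\mathcal{T}$ is $\xi=(1\otimes\tau)\cdot(\tau\otimes 1)$, i.e. $\xi(x_1\otimes x_2\otimes x_3)=(-1)^{[x_1]([x_2]+[x_3])}x_2\otimes x_3\otimes x_1$. The adjoint diagonal action of $\mathcal{T}$ on $\mathcal{T}\otimes\mathcal{T}$ is $x\cdot\big(\sum_i a_i\otimes b_i\big)=\sum_i\big([x,a_i]\otimes b_i+(-1)^{[x][a_i]}a_i\otimes[x,b_i]\big)$. A Lie super-coalgebra is a pair $(\mathcal{T},\Delta)$ with $\mathcal{T}$ a super-vector space and $\Delta:\mathcal{T}\to\mathcal{T}\otimes\mathcal{T}$ linear such that $\Delta(\mathcal{T}^i)\subset\sum_{j+k=i}\mathcal{T}^j\otimes\mathcal{T}^k$, $\mathrm{Im}\,\Delta\subset\mathrm{Im}(1\otimes 1-\tau)$, and $(\mathbf{1}+\xi+\xi^2)\cdot(1\otimes\Delta)\cdot\Delta=0$. A Lie super-bialgebra is a triple $(\mathcal{T},[\cdot,\cdot],\Delta)$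 such that $(\mathcal{T},[\cdot,\cdot])$ is a Lie superalgebra, $(\mathcal{T},\Delta)$ is a Lie super-coalgebra, and $\Delta([x,y])=x\cdot\Delta(y)-(-1)^{[x][y]}y\cdot\Delta(x)$ for all $x,y\in\mathcal{T}$. A Lie super-bialgebra structure on $\mathcal{T}$ is a map $\Delta$ making $\mathcal{T}$ with its given bracket a Lie super-bialgebra. For homogeneous $r=\sum_i a_i\otimes b_i\in\mathcal{T}\otimes\mathcal{T}$ (so $[r]=[a_i]+[b_i]$), the coboundary $\Delta_r:\mathcal{T}\to\mathcal{T}\otimes\mathcal{T}$ is $\Delta_r(x)=(-1)^{[r][x]}x\cdot r$. A Lie super-bialgebra is coboundary if $\Delta=\Delta_r$ for some $r\in\mathrm{Im}(1\otimes 1-\tau)$, and a coboundary one is triangular if in addition $$c(r):=[r^{12},r^{13}]+[r^{12},r^{23}]+[r^{13},r^{23}]=0,$$ where $r^{12}=\sum_i a_i\otimes b_i\otimes 1$, $r^{13}=\sum_i a_i\otimes 1\otimes b_i$, $r^{23}=\sum_i 1\otimes a_i\otimes b_i$, viewed in $U(\mathcal{T})^{\otimes 3}$ ($U(\mathcal{T})$ the universal enveloping superalgebra, the tensor product carrying the usual sign rule), and the brackets are supercommutators. *)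

theory Defs
  imports Complex_Main "HOL-Library.Poly_Mapping" "HOL-Library.Z2"
begin

section \<open>Complex vector spaces with a fixed basis\<close>

text \<open>
  The complex vector space with basis \<^typ>\<open>'a\<close> is the space of finitely supported functions
  from \<^typ>\<open>'a\<close> to the complex numbers.  The tensor product of the spaces with bases
  \<^typ>\<open>'a\<close> and \<^typ>\<open>'b\<close> is the space with basis \<^typ>\<open>'a \<times> 'b\<close>; a triple tensor product has
  basis \<^typ>\<open>'a \<times> 'b \<times> 'c\<close>, so that \<open>x \<otimes> (y \<otimes> z)\<close> is \<open>tensor x (tensor y z)\<close>.
\<close>

type_synonym 'a cvec = "'a \<Rightarrow>\<^sub>0 complex"

definition scale :: "complex \<Rightarrow> 'a cvec \<Rightarrow> 'a cvec" where
  "scale c x = Poly_Mapping.map ((*) c) x"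

definition basis :: "'a \<Rightarrow> 'a cvec" where
  "basis a = Poly_Mapping.single a 1"

definition extend :: "('a \<Rightarrow> 'b cvec) \<Rightarrow> 'a cvec \<Rightarrow> 'b cvec" where
  "extend f x = (\<Sum>a\<in>Poly_Mapping.keys x. scale (Poly_Mapping.lookup x a) (f a))"

definition extend2 :: "('a \<Rightarrow> 'b \<Rightarrow> 'c cvec) \<Rightarrow> 'a cvec \<Rightarrow> 'b cvec \<Rightarrow> 'c cvec" where
  "extend2 f x y = extend (\<lambda>a. extend (\<lambda>b. f a b) y) x"

definition tensor :: "'a cvec \<Rightarrow> 'b cvec \<Rightarrow> ('a \<times> 'b) cvec" where
  "tensor = extend2 (\<lambda>a b. basis (a, b))"

lemma lookup_scale [simp]: "Poly_Mapping.lookup (scale c x) a = c * Poly_Mapping.lookup x a"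
  by (simp add: scale_def Poly_Mapping.map.rep_eq when_def)

global_interpretation cvec: vector_space "scale :: complex \<Rightarrow> 'a cvec \<Rightarrow> 'a cvec"
  by unfold_locales
    (rule poly_mapping_eqI, simp add: lookup_add algebra_simps)+

abbreviation linear_map :: "('a cvec \<Rightarrow> 'b cvec) \<Rightarrow> bool" where
  "linear_map \<equiv> Vector_Spaces.linear scale scale"

lemma extend_linear: "linear_map (extend f)"
proof -
  have fin: "extend f x = (\<Sum>a\<in>S. scale (Poly_Mapping.lookup x a) (f a))"
    if "finite S" "Poly_Mapping.keys x \<subseteq> S" for x S
    unfolding extend_def using that
    by (intro sum.mono_neutral_left) (auto simp: in_keys_iff)
  have "extend f (x + y) = extend f x + extend f y" for x y
  proof -
    let ?S = "Poly_Mapping.keys x \<union> Poly_Mapping.keys y"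
    have "Poly_Mapping.keys (x + y) \<subseteq> ?S" by (rule Poly_Mapping.keys_add)
    then show ?thesis
      by (simp add: fin[of ?S] lookup_add cvec.scale_left_distrib sum.distrib)
  qed
  moreover have "extend f (scale c x) = scale c (extend f x)" for c x
  proof -
    have "Poly_Mapping.keys (scale c x) \<subseteq> Poly_Mapping.keys x"
      by (auto simp: in_keys_iff)
    then show ?thesis
      by (simp add: fin[of "Poly_Mapping.keys x"] cvec.scale_sum_right)
  qed
  ultimately show ?thesis
    by unfold_locales
qed

lemma extend_basis [simp]: "extend f (basis a) = f a"
  by (simp add: extend_def basis_def)

section \<open>Super-vector spaces\<close>

text \<open>
  A super-vector space with a homogeneous basis is given by a parity function on the basis.
  Signs are \<open>(-1)\<close> to the power of an element of the field \<^typ>\<open>bit\<close> of integers modulo 2.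
\<close>

definition ksign :: "bit \<Rightarrow> complex" where
  "ksign k = (if k = 0 then 1 else - 1)"

definition homogeneous :: "('b \<Rightarrow> bit) \<Rightarrow> bit \<Rightarrow> 'b cvec set" where
  "homogeneous p k = cvec.span (basis ` {b. p b = k})"

definition parity2 :: "('b \<Rightarrow> bit) \<Rightarrow> 'b \<times> 'b \<Rightarrow> bit" where
  "parity2 p = (\<lambda>(a, b). p a + p b)"

definition super_twist :: "('b \<Rightarrow> bit) \<Rightarrow> ('b \<times> 'b) cvec \<Rightarrow> ('b \<times> 'b) cvec" where
  "super_twist p = extend (\<lambda>(a, b). scale (ksign (p a * p b)) (basis (b, a)))"

definition super_cyclic :: "('b \<Rightarrow> bit) \<Rightarrow> ('b \<times> 'b \<times> 'b) cvec \<Rightarrow> ('b \<times> 'b \<times> 'b) cvec" where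
  "super_cyclic p = extend (\<lambda>(a, b, c). scale (ksign (p a * (p b + p c))) (basis (b, c, a)))"

definition id_tensor :: "('b cvec \<Rightarrow> ('b \<times> 'b) cvec) \<Rightarrow> ('b \<times> 'b) cvec \<Rightarrow> ('b \<times> 'b \<times> 'b) cvec" where
  "id_tensor D = extend (\<lambda>(a, b). tensor (basis a) (D (basis b)))"

definition im_one_minus_twist :: "('b \<Rightarrow> bit) \<Rightarrow> ('b \<times> 'b) cvec set" where
  "im_one_minus_twist p = range (\<lambda>t. t - super_twist p t)"

section \<open>Lie superalgebras, super-coalgebras and super-bialgebras\<close>

definition lie_superalgebra :: "('b \<Rightarrow> bit) \<Rightarrow> ('b cvec \<Rightarrow> 'b cvec \<Rightarrow> 'b cvec) \<Rightarrow> bool" where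
  "lie_superalgebra p br \<longleftrightarrow>
     (\<forall>x. linear_map (br x)) \<and> (\<forall>y. linear_map (\<lambda>x. br x y)) \<and>
     (\<forall>i j. \<forall>x\<in>homogeneous p i. \<forall>y\<in>homogeneous p j.
        br x y \<in> homogeneous p (i + j) \<and>
        br x y = - scale (ksign (i * j)) (br y x) \<and>
        (\<forall>z. br x (br y z) = br (br x y) z + scale (ksign (i * j)) (br y (br x z))))"

definition lie_supercoalgebra :: "('b \<Rightarrow> bit) \<Rightarrow> ('b cvec \<Rightarrow> ('b \<times> 'b) cvec) \<Rightarrow> bool" where
  "lie_supercoalgebra p D \<longleftrightarrow>
     linear_map D \<and>
     (\<forall>i. D ` homogeneous p i \<subseteq> homogeneous (parity2 p) i) \<and>
     range D \<subseteq> im_one_minus_twist p \<and>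
     (\<forall>x. let t = id_tensor D (D x)
          in t + super_cyclic p t + super_cyclic p (super_cyclic p t) = 0)"

definition diag_action ::
  "('b \<Rightarrow> bit) \<Rightarrow> ('b cvec \<Rightarrow> 'b cvec \<Rightarrow> 'b cvec) \<Rightarrow> 'b cvec \<Rightarrow> ('b \<times> 'b) cvec \<Rightarrow> ('b \<times> 'b) cvec" where
  "diag_action p br = extend2 (\<lambda>x (a, b).
     tensor (br (basis x) (basis a)) (basis b) +
     scale (ksign (p x * p a)) (tensor (basis a) (br (basis x) (basis b))))"

definition lie_superbialgebra ::
  "('b \<Rightarrow> bit) \<Rightarrow> ('b cvec \<Rightarrow> 'b cvec \<Rightarrow> 'b cvec) \<Rightarrow> ('b cvec \<Rightarrow> ('b \<times> 'b) cvec) \<Rightarrow> bool" where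
  "lie_superbialgebra p br D \<longleftrightarrow>
     lie_superalgebra p br \<and> lie_supercoalgebra p D \<and>
     (\<forall>i j. \<forall>x\<in>homogeneous p i. \<forall>y\<in>homogeneous p j.
        D (br x y) = diag_action p br x (D y) - scale (ksign (i * j)) (diag_action p br y (D x)))"

text \<open>
  \<open>\<Delta>\<^sub>r\<close>, bilinear in \<open>r\<close> and the argument; for homogeneous \<open>r\<close> and \<open>x\<close> it is
  \<open>(-1)\<^bsup>[r][x]\<^esup> x \<cdot> r\<close>.
\<close>

definition coboundary ::
  "('b \<Rightarrow> bit) \<Rightarrow> ('b cvec \<Rightarrow> 'b cvec \<Rightarrow> 'b cvec) \<Rightarrow> ('b \<times> 'b) cvec \<Rightarrow> 'b cvec \<Rightarrow> ('b \<times> 'b) cvec" where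
  "coboundary p br = extend2 (\<lambda>t x.
     scale (ksign (parity2 p t * p x)) (diag_action p br (basis x) (basis t)))"

section \<open>The enveloping superalgebra and the classical Yang--Baxter equation\<close>

text \<open>
  The tensor superalgebra \<open>T(V)\<close> has the words over the basis of \<open>V\<close> as basis and concatenation
  as product.  The enveloping superalgebra \<open>U(V)\<close> is \<open>T(V)\<close> modulo \<open>enveloping_ideal\<close>, the
  two-sided ideal generated by \<open>x y - (-1)\<^bsup>[x][y]\<^esup> y x - [x, y]\<close>.
  Elements of \<open>U(V) \<otimes> U(V) \<otimes> U(V)\<close> are represented in \<open>T(V) \<otimes> T(V) \<otimes> T(V)\<close>, and
  \<open>enveloping_kernel3\<close> is the kernel of the projection, that is,
  \<open>I \<otimes> T(V) \<otimes> T(V) + T(V) \<otimes> I \<otimes> T(V) + T(V) \<otimes> T(V) \<otimes> I\<close> where \<open>I\<close> is the enveloping ideal.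
\<close>

definition word_mult :: "'b list cvec \<Rightarrow> 'b list cvec \<Rightarrow> 'b list cvec" where
  "word_mult = extend2 (\<lambda>u v. basis (u @ v))"

definition word_incl :: "'b cvec \<Rightarrow> 'b list cvec" where
  "word_incl = extend (\<lambda>a. basis [a])"

definition enveloping_ideal :: "('b \<Rightarrow> bit) \<Rightarrow> ('b cvec \<Rightarrow> 'b cvec \<Rightarrow> 'b cvec) \<Rightarrow> 'b list cvec set" where
  "enveloping_ideal p br = cvec.span
     {word_mult u (word_mult
        (word_mult (word_incl x) (word_incl y)
          - scale (ksign (i * j)) (word_mult (word_incl y) (word_incl x))
          - word_incl (br x y)) v)
      | u v x y i j. x \<in> homogeneous p i \<and> y \<in> homogeneous p j}"

definition enveloping_kernel3 ::
  "('b \<Rightarrow> bit) \<Rightarrow> ('b cvec \<Rightarrow> 'b cvec \<Rightarrow> 'b cvec) \<Rightarrow> ('b list \<times> 'b list \<times> 'b list) cvec set" where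
  "enveloping_kernel3 p br = cvec.span
     {tensor u (tensor v w) | u v w.
        u \<in> enveloping_ideal p br \<or> v \<in> enveloping_ideal p br \<or> w \<in> enveloping_ideal p br}"

definition word_parity :: "('b \<Rightarrow> bit) \<Rightarrow> 'b list \<Rightarrow> bit" where
  "word_parity p w = sum_list (map p w)"

definition parity3 :: "('b \<Rightarrow> bit) \<Rightarrow> 'b list \<times> 'b list \<times> 'b list \<Rightarrow> bit" where
  "parity3 p = (\<lambda>(u, v, w). word_parity p u + word_parity p v + word_parity p w)"

definition mult3 :: "('b \<Rightarrow> bit) \<Rightarrow> ('b list \<times> 'b list \<times> 'b list) cvec
    \<Rightarrow> ('b list \<times> 'b list \<times> 'b list) cvec \<Rightarrow> ('b list \<times> 'b list \<times> 'b list) cvec" where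
  "mult3 p = extend2 (\<lambda>(u, v, w) (u', v', w').
     scale (ksign (word_parity p v * word_parity p u'
                 + word_parity p w * word_parity p u'
                 + word_parity p w * word_parity p v'))
       (basis (u @ u', v @ v', w @ w')))"

definition supercommutator3 :: "('b \<Rightarrow> bit) \<Rightarrow> ('b list \<times> 'b list \<times> 'b list) cvec
    \<Rightarrow> ('b list \<times> 'b list \<times> 'b list) cvec \<Rightarrow> ('b list \<times> 'b list \<times> 'b list) cvec" where
  "supercommutator3 p = extend2 (\<lambda>s t.
     mult3 p (basis s) (basis t)
       - scale (ksign (parity3 p s * parity3 p t)) (mult3 p (basis t) (basis s)))"

definition r12 :: "('b \<times> 'b) cvec \<Rightarrow> ('b list \<times> 'b list \<times> 'b list) cvec" where
  "r12 = extend (\<lambda>(a, b). basis ([a], [b], []))"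

definition r13 :: "('b \<times> 'b) cvec \<Rightarrow> ('b list \<times> 'b list \<times> 'b list) cvec" where
  "r13 = extend (\<lambda>(a, b). basis ([a], [], [b]))"

definition r23 :: "('b \<times> 'b) cvec \<Rightarrow> ('b list \<times> 'b list \<times> 'b list) cvec" where
  "r23 = extend (\<lambda>(a, b). basis ([], [a], [b]))"

definition cybe_elem :: "('b \<Rightarrow> bit) \<Rightarrow> ('b \<times> 'b) cvec \<Rightarrow> ('b list \<times> 'b list \<times> 'b list) cvec" where
  "cybe_elem p r = supercommutator3 p (r12 r) (r13 r)
     + supercommutator3 p (r12 r) (r23 r) + supercommutator3 p (r13 r) (r23 r)"

definition satisfies_cybe ::
  "('b \<Rightarrow> bit) \<Rightarrow> ('b cvec \<Rightarrow> 'b cvec \<Rightarrow> 'b cvec) \<Rightarrow> ('b \<times> 'b) cvec \<Rightarrow> bool" where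
  "satisfies_cybe p br r \<longleftrightarrow> cybe_elem p r \<in> enveloping_kernel3 p br"

section \<open>The centerless topological N=2 superconformal algebra\<close>

datatype n2_basis = Lgen int | Hgen int | Ggen int | Qgen int

fun n2_parity :: "n2_basis \<Rightarrow> bit" where
  "n2_parity (Lgen _) = 0"
| "n2_parity (Hgen _) = 0"
| "n2_parity (Ggen _) = 1"
| "n2_parity (Qgen _) = 1"

text \<open>
  The brackets in the order in which they are usually listed come first; then those
  determined by super-skew-symmetry (note that \<open>[Q\<^sub>m, G\<^sub>n] = [G\<^sub>n, Q\<^sub>m]\<close>); then the vanishing ones.
\<close>

fun n2_basis_bracket :: "n2_basis \<Rightarrow> n2_basis \<Rightarrow> n2_basis cvec" where
  "n2_basis_bracket (Lgen m) (Lgen n) = scale (of_int (m - n)) (basis (Lgen (m + n)))"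
| "n2_basis_bracket (Lgen m) (Hgen n) = scale (- of_int n) (basis (Hgen (m + n)))"
| "n2_basis_bracket (Lgen m) (Ggen n) = scale (of_int (m - n)) (basis (Ggen (m + n)))"
| "n2_basis_bracket (Lgen m) (Qgen n) = scale (- of_int n) (basis (Qgen (m + n)))"
| "n2_basis_bracket (Hgen m) (Ggen n) = basis (Ggen (m + n))"
| "n2_basis_bracket (Hgen m) (Qgen n) = - basis (Qgen (m + n))"
| "n2_basis_bracket (Ggen m) (Qgen n) =
     scale 2 (basis (Lgen (m + n))) - scale (2 * of_int n) (basis (Hgen (m + n)))"
| "n2_basis_bracket (Hgen m) (Lgen n) = scale (of_int m) (basis (Hgen (m + n)))"
| "n2_basis_bracket (Ggen m) (Lgen n) = scale (of_int (m - n)) (basis (Ggen (m + n)))"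
| "n2_basis_bracket (Qgen m) (Lgen n) = scale (of_int m) (basis (Qgen (m + n)))"
| "n2_basis_bracket (Ggen m) (Hgen n) = - basis (Ggen (m + n))"
| "n2_basis_bracket (Qgen m) (Hgen n) = basis (Qgen (m + n))"
| "n2_basis_bracket (Qgen m) (Ggen n) =
     scale 2 (basis (Lgen (m + n))) - scale (2 * of_int m) (basis (Hgen (m + n)))"
| "n2_basis_bracket (Hgen _) (Hgen _) = 0"
| "n2_basis_bracket (Ggen _) (Ggen _) = 0"
| "n2_basis_bracket (Qgen _) (Qgen _) = 0"

definition n2_bracket :: "n2_basis cvec \<Rightarrow> n2_basis cvec \<Rightarrow> n2_basis cvec" where
  "n2_bracket = extend2 n2_basis_bracket"

section \<open>Basic facts\<close>

lemma linear_map_iff: "linear_map f \<longleftrightarrow> (\<forall>x y. f (x + y) = f x + f y) \<and> (\<forall>c x. f (scale c x) = scale c (f x))"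
proof
  assume "linear_map f"
  then interpret Vector_Spaces.linear scale scale f .
  show "(\<forall>x y. f (x + y) = f x + f y) \<and> (\<forall>c x. f (scale c x) = scale c (f x))"
    by (simp add: add scale)
qed (unfold_locales, auto)

lemma extend2_linear: "linear_map (extend2 f x)" "linear_map (\<lambda>x. extend2 f x y)"
proof -
  have l: "extend g (x + y) = extend g x + extend g y" 
    "extend g (scale c x) = scale c (extend g x)" for g :: "'d => 'e cvec" and x y c
    using extend_linear[of g] by (auto simp: linear_map_iff)
  show "linear_map (extend2 f x)"
    unfolding linear_map_iff extend2_def
    by (simp add: l) (simp add: extend_def cvec.scale_right_distrib sum.distrib cvec.scale_sum_right mult_ac)
  show "linear_map (\<lambda>x. extend2 f x y)"
    unfolding linear_map_iff extend2_def by (simp add: l)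
qed

lemma extend2_basis [simp]: "extend2 f (basis a) (basis b) = f a b"
  by (simp add: extend2_def)

lemma n2_bracket_linear:
  "n2_bracket (x + y) z = n2_bracket x z + n2_bracket y z"
  "n2_bracket z (x + y) = n2_bracket z x + n2_bracket z y"
  "n2_bracket (scale c x) z = scale c (n2_bracket x z)"
  "n2_bracket z (scale c x) = scale c (n2_bracket z x)"
  "n2_bracket (x - y) z = n2_bracket x z - n2_bracket y z"
  "n2_bracket z (x - y) = n2_bracket z x - n2_bracket z y"
  "n2_bracket (- x) z = - n2_bracket x z"
  "n2_bracket z (- x) = - n2_bracket z x"
  "n2_bracket 0 z = 0"
  "n2_bracket z 0 = 0"
proof -
  note l = extend2_linear(1)[of n2_basis_bracket, folded n2_bracket_def]
  note r = extend2_linear(2)[of n2_basis_bracket, folded n2_bracket_def]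
  interpret l: Vector_Spaces.linear scale scale "n2_bracket z" by (rule l)
  interpret r: Vector_Spaces.linear scale scale "\<lambda>x. n2_bracket x z" by (rule r)
  show  "n2_bracket (x + y) z = n2_bracket x z + n2_bracket y z"
  "n2_bracket z (x + y) = n2_bracket z x + n2_bracket z y"
  "n2_bracket (scale c x) z = scale c (n2_bracket x z)"
  "n2_bracket z (scale c x) = scale c (n2_bracket z x)"
  "n2_bracket (x - y) z = n2_bracket x z - n2_bracket y z"
  "n2_bracket z (x - y) = n2_bracket z x - n2_bracket z y"
  "n2_bracket (- x) z = - n2_bracket x z"
  "n2_bracket z (- x) = - n2_bracket z x"
  "n2_bracket 0 z = 0"
  "n2_bracket z 0 = 0"
  by (simp_all add: l.add r.add l.scale r.scale l.diff r.diff l.neg r.neg l.zero r.zero)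
qed

lemma n2_bracket_basis [simp]: "n2_bracket (basis a) (basis b) = n2_basis_bracket a b"
  by (simp add: n2_bracket_def)

lemma lookup_basis: "Poly_Mapping.lookup (basis a) b = (if a = b then 1 else 0)"
  by (simp add: basis_def lookup_single when_def)

lemma n2_skew: "n2_basis_bracket a b = - scale (ksign (n2_parity a * n2_parity b)) (n2_basis_bracket b a)"
  by (cases a; cases b)
    (auto intro!: poly_mapping_eqI simp: ksign_def lookup_basis lookup_minus algebra_simps)

lemma n2_jacobi: "n2_bracket (basis a) (n2_basis_bracket b c) = n2_bracket (n2_basis_bracket a b) (basis c)
  + scale (ksign (n2_parity a * n2_parity b)) (n2_bracket (basis b) (n2_basis_bracket a c))"
  by (cases a; cases b; cases c)
    (auto intro!: poly_mapping_eqI simp: n2_bracket_linear ksign_def lookup_basis lookup_minus lookup_add algebra_simps)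

lemma homogeneous_closed:
  "p a = k \<Longrightarrow> basis a \<in> homogeneous p k"
  "0 \<in> homogeneous p k"
  "x \<in> homogeneous p k \<Longrightarrow> scale c x \<in> homogeneous p k"
  "x \<in> homogeneous p k \<Longrightarrow> - x \<in> homogeneous p k"
  "x \<in> homogeneous p k \<Longrightarrow> y \<in> homogeneous p k \<Longrightarrow> x + y \<in> homogeneous p k"
  "x \<in> homogeneous p k \<Longrightarrow> y \<in> homogeneous p k \<Longrightarrow> x - y \<in> homogeneous p k"
  unfolding homogeneous_def
  by (simp_all add: cvec.span_base cvec.span_zero cvec.span_scale cvec.span_neg
      cvec.span_add cvec.span_diff)

lemma n2_basis_parity: "n2_basis_bracket a b \<in> homogeneous n2_parity (n2_parity a + n2_parity b)"
  by (cases a; cases b)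
    (simp_all add: homogeneous_closed)

lemma homogeneous_induct:
  assumes "x \<in> homogeneous p i" "\<And>a. p a = i \<Longrightarrow> P (basis a)" "\<And>c x y. P x \<Longrightarrow> P y \<Longrightarrow> P (scale c x + y)" "P 0"
  shows "P x"
  using assms(1) unfolding homogeneous_def
  by (induction rule: cvec.span_induct_alt) (use assms in auto)

lemma cvec_induct:
  fixes x :: "'a cvec"
  assumes "\<And>a. P (basis a)" "\<And>c x y. P x \<Longrightarrow> P y \<Longrightarrow> P (scale c x + y)" "P 0"
  shows "P x"
proof (rule homogeneous_induct[where p="\<lambda>_. 0" and i=0])
  have "x = extend basis x"
    by (rule poly_mapping_eqI)
     (simp add: extend_def lookup_sum lookup_basis in_keys_iff if_distrib[of "(*) _"] cong: if_cong)
  also have "\<dots> \<in> homogeneous (\<lambda>_. 0) 0"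
    unfolding extend_def homogeneous_def
    by (intro cvec.span_sum cvec.span_scale cvec.span_base) auto
  finally show "x \<in> homogeneous (\<lambda>_. 0) 0" .
qed (use assms in auto)

theorem n2_lie_superalgebra: "lie_superalgebra n2_parity n2_bracket"
  unfolding lie_superalgebra_def
proof (intro conjI allI ballI)
  show "linear_map (n2_bracket x)" "linear_map (\<lambda>x. n2_bracket x y)" for x y
    unfolding n2_bracket_def by (rule extend2_linear)+
  fix i j x y
  assume x: "x \<in> homogeneous n2_parity i" and y: "y \<in> homogeneous n2_parity j"
  have 1: "n2_bracket (basis a) y \<in> homogeneous n2_parity (n2_parity a + j)" for a
    using y by (rule homogeneous_induct)
      (metis n2_bracket_basis n2_basis_parity, simp_all only: n2_bracket_linear homogeneous_closed)
  show "n2_bracket x y \<in> homogeneous n2_parity (i + j)"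
    using x by (rule homogeneous_induct)
      (metis 1, simp_all only: n2_bracket_linear homogeneous_closed)
  have 2: "n2_bracket (basis a) y = - scale (ksign (n2_parity a * j)) (n2_bracket y (basis a))" for a
    using y
  proof (rule homogeneous_induct)
    fix b assume "n2_parity b = j"
    then show "n2_bracket (basis a) (basis b)
        = - scale (ksign (n2_parity a * j)) (n2_bracket (basis b) (basis a))"
      using n2_skew[of a b] by simp
  qed (simp_all add: n2_bracket_linear cvec.scale_right_distrib mult.commute)
  show "n2_bracket x y = - scale (ksign (i * j)) (n2_bracket y x)"
    using x
  proof (rule homogeneous_induct)
    fix a assume "n2_parity a = i"
    then show "n2_bracket (basis a) y = - scale (ksign (i * j)) (n2_bracket y (basis a))"
      using 2[of a] by simp
  qed (simp_all add: n2_bracket_linear cvec.scale_right_distrib mult.commute)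
  fix z
  have 3: "n2_bracket (basis a) (n2_bracket (basis b) z) = n2_bracket (n2_bracket (basis a) (basis b)) z
      + scale (ksign (n2_parity a * n2_parity b)) (n2_bracket (basis b) (n2_bracket (basis a) z))" for a b
  proof (rule cvec_induct[of _ z])
    fix c
    show "n2_bracket (basis a) (n2_bracket (basis b) (basis c))
      = n2_bracket (n2_bracket (basis a) (basis b)) (basis c)
      + scale (ksign (n2_parity a * n2_parity b)) (n2_bracket (basis b) (n2_bracket (basis a) (basis c)))"
      using n2_jacobi[of a b c] by simp
  qed (simp_all add: n2_bracket_linear cvec.scale_right_distrib mult.commute)
  have 4: "n2_bracket (basis a) (n2_bracket y z) = n2_bracket (n2_bracket (basis a) y) z
      + scale (ksign (n2_parity a * j)) (n2_bracket y (n2_bracket (basis a) z))" for a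
    using y
  proof (rule homogeneous_induct)
    fix b assume "n2_parity b = j"
    then show "n2_bracket (basis a) (n2_bracket (basis b) z) = n2_bracket (n2_bracket (basis a) (basis b)) z
      + scale (ksign (n2_parity a * j)) (n2_bracket (basis b) (n2_bracket (basis a) z))"
      using 3[of a b] by simp
  qed (simp_all add: n2_bracket_linear cvec.scale_right_distrib mult.commute)
  show "n2_bracket x (n2_bracket y z)
      = n2_bracket (n2_bracket x y) z + scale (ksign (i * j)) (n2_bracket y (n2_bracket x z))"
    using x
  proof (rule homogeneous_induct)
    fix a assume "n2_parity a = i"
    then show "n2_bracket (basis a) (n2_bracket y z) = n2_bracket (n2_bracket (basis a) y) z
      + scale (ksign (i * j)) (n2_bracket y (n2_bracket (basis a) z))"
      using 4[of a] by simp
  qed (simp_all add: n2_bracket_linear cvec.scale_right_distrib mult.commute)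
qed

lemma extend2_add_scale:
  "extend2 f (scale c x + x') y = scale c (extend2 f x y) + extend2 f x' y"
  "extend2 f y' (scale c y + z) = scale c (extend2 f y' y) + extend2 f y' z"
  "extend2 f 0 y = 0" "extend2 f x 0 = 0"
proof -
  interpret l: Vector_Spaces.linear scale scale "extend2 f u" for u
    by (rule extend2_linear)
  interpret r: Vector_Spaces.linear scale scale "\<lambda>x. extend2 f x u" for u
    by (rule extend2_linear)
  show "extend2 f (scale c x + x') y = scale c (extend2 f x y) + extend2 f x' y"
    by (simp only: r.add r.scale)
  show "extend2 f y' (scale c y + z) = scale c (extend2 f y' y) + extend2 f y' z"
    by (simp only: l.add l.scale)
  show "extend2 f 0 y = 0" "extend2 f x 0 = 0"
    by (rule r.zero, rule l.zero)
qed

lemma coboundary_homogeneous: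
  assumes r: "r \<in> homogeneous (parity2 p) k" and x: "x \<in> homogeneous p i"
  shows "coboundary p br r x = scale (ksign (k * i)) (diag_action p br x r)"
proof -
  note cob = extend2_add_scale[where f = "\<lambda>t x. scale (ksign (parity2 p t * p x))
    (diag_action p br (basis x) (basis t))", folded coboundary_def]
  note act = extend2_add_scale[where f = "\<lambda>x (a, b).
     tensor (br (basis x) (basis a)) (basis b) +
     scale (ksign (p x * p a)) (tensor (basis a) (br (basis x) (basis b)))", folded diag_action_def]
  have 0: "coboundary p br (basis t) (basis a)
      = scale (ksign (parity2 p t * p a)) (diag_action p br (basis a) (basis t))" for t a
    by (simp only: coboundary_def extend2_basis)
  have 1: "coboundary p br (basis t) x = scale (ksign (parity2 p t * i)) (diag_action p br x (basis t))" for t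
    using x by (rule homogeneous_induct)
      (simp_all add: 0 cob act cvec.scale_right_distrib mult.commute)
  show ?thesis
    using r by (rule homogeneous_induct)
      (simp_all add: 1 cob act cvec.scale_right_distrib mult.commute)
qed

end

theory Submission
  imports Defs
begin

text \<open>
  A bialgebra structure \<open>\<Delta>\<close> is an even 1-cocycle with values in \<open>T \<otimes> T\<close>. Subtracting coboundaries one
  makes it compatible with weight and charge (using \<open>L\<^sub>0 + \<i> H\<^sub>0\<close>), and then vanish on \<open>Q\<^sub>0\<close>, \<open>Q\<^sub>1\<close> and
  \<open>Q\<^sub>2\<close>: the first because \<open>ad Q\<^sub>0\<close> is an acyclic differential, the second by solving a linear equation,
  the third because the relation \<open>[Q\<^sub>2, L\<^sub>-\<^sub>1] = 2 Q\<^sub>1\<close> removes the only obstruction. Then it vanishes on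
  all \<open>Q\<^sub>k\<close>, so that its values on \<open>H\<^sub>n\<close>, \<open>L\<^sub>n\<close> and finally \<open>G\<^sub>n\<close> are killed by every \<open>Q\<^sub>m\<close>; such
  elements are supported on \<open>Q \<otimes> Q\<close> and vanish by their charge. Hence \<open>\<Delta> = \<Delta>\<^sub>r\<close> with \<open>r\<close> even.

  Both \<open>r + \<tau> r\<close> and, by the co-Jacobi identity, \<open>c(r)\<close> are invariant under \<open>T\<close>, and the same support
  argument shows that invariants in tensor powers of \<open>T\<close> are zero.
\<close>

section \<open>Linear extensions and tensors\<close>

lemma extend_simps:
  "extend f (x + y) = extend f x + extend f y"
  "extend f (scale c x) = scale c (extend f x)"
  "extend f (x - y) = extend f x - extend f y"
  "extend f (- x) = - extend f x"
  "extend f 0 = 0"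
proof -
  interpret Vector_Spaces.linear scale scale "extend f" by (rule extend_linear)
  show "extend f (x + y) = extend f x + extend f y" "extend f (scale c x) = scale c (extend f x)"
    "extend f (x - y) = extend f x - extend f y" "extend f (- x) = - extend f x" "extend f 0 = 0"
    by (simp_all only: add scale diff neg zero)
qed

lemma extend_fun_simps:
  "extend (\<lambda>a. f a + g a) x = extend f x + extend g x"
  "extend (\<lambda>a. f a - g a) x = extend f x - extend g x"
  "extend (\<lambda>a. - f a) x = - extend f x"
  "extend (\<lambda>a. scale c (f a)) x = scale c (extend f x)"
  unfolding extend_def
  by (simp_all add: cvec.scale_right_distrib cvec.scale_right_diff_distrib sum.distrib sum_subtractf
      sum_negf cvec.scale_sum_right mult.commute)

lemma linear_extend:
  assumes "linear_map f"
  shows "f (extend g x) = extend (\<lambda>a. f (g a)) x"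
proof (rule cvec_induct[of _ x])
  have "f (0::'a cvec) = 0" using assms unfolding linear_map_iff by (metis cvec.scale_zero_left)
  then show "f (extend g 0) = extend (\<lambda>a. f (g a)) 0" by (simp add: extend_simps)
qed (use assms in \<open>auto simp: linear_map_iff extend_simps\<close>)

lemma linear_map_eqI:
  assumes "linear_map f" "linear_map g" "\<And>a. f (basis a) = g (basis a)"
  shows "f = g"
proof
  fix x
  have "f (extend basis x) = g (extend basis x)"
    using assms by (simp add: linear_extend)
  moreover have "extend basis x = x"
    by (rule cvec_induct[of _ x]) (simp_all add: extend_simps)
  ultimately show "f x = g x" by simp
qed

lemma extend_cong:
  assumes "\<And>a. Poly_Mapping.lookup x a \<noteq> 0 \<Longrightarrow> f a = g a"
  shows "extend f x = extend g x"
  unfolding extend_def using assms by (intro sum.cong) (auto simp: in_keys_iff)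

lemma extend_in_span:
  assumes "\<And>a. Poly_Mapping.lookup x a \<noteq> 0 \<Longrightarrow> f a \<in> cvec.span S"
  shows "extend f x \<in> cvec.span S"
  unfolding extend_def using assms
  by (intro cvec.span_sum cvec.span_scale) (auto simp: in_keys_iff)

lemma lookup_extend_diagonal:
  "Poly_Mapping.lookup (extend (\<lambda>a. scale (w a) (basis a)) x) a = w a * Poly_Mapping.lookup x a"
  by (rule cvec_induct[of _ x]) (auto simp: extend_simps lookup_add lookup_basis algebra_simps)

lemma homogeneous_iff:
  "x \<in> homogeneous p k \<longleftrightarrow> (\<forall>a. Poly_Mapping.lookup x a \<noteq> 0 \<longrightarrow> p a = k)"
proof
  assume "x \<in> homogeneous p k"
  then show "\<forall>a. Poly_Mapping.lookup x a \<noteq> 0 \<longrightarrow> p a = k"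
  proof (rule homogeneous_induct)
    fix c and x y :: "'a cvec"
    assume *: "\<forall>a. Poly_Mapping.lookup x a \<noteq> 0 \<longrightarrow> p a = k"
      "\<forall>a. Poly_Mapping.lookup y a \<noteq> 0 \<longrightarrow> p a = k"
    show "\<forall>a. Poly_Mapping.lookup (scale c x + y) a \<noteq> 0 \<longrightarrow> p a = k"
    proof (intro allI impI)
      fix a assume "Poly_Mapping.lookup (scale c x + y) a \<noteq> 0"
      then have "Poly_Mapping.lookup x a \<noteq> 0 \<or> Poly_Mapping.lookup y a \<noteq> 0"
        by (auto simp: lookup_add)
      with * show "p a = k" by blast
    qed
  qed (auto simp: lookup_basis)
next
  assume *: "\<forall>a. Poly_Mapping.lookup x a \<noteq> 0 \<longrightarrow> p a = k"
  have "extend basis x = x"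
    by (rule cvec_induct[of _ x]) (simp_all add: extend_simps)
  moreover have "extend basis x \<in> homogeneous p k"
    unfolding homogeneous_def using *
    by (intro extend_in_span cvec.span_base) auto
  ultimately show "x \<in> homogeneous p k" by simp
qed

lemma lookup_tensor:
  "Poly_Mapping.lookup (tensor x y) t = Poly_Mapping.lookup x (fst t) * Poly_Mapping.lookup y (snd t)"
proof (rule cvec_induct[of _ x])
  fix a
  show "Poly_Mapping.lookup (tensor (basis a) y) t
      = Poly_Mapping.lookup (basis a) (fst t) * Poly_Mapping.lookup y (snd t)"
    by (rule cvec_induct[of _ y], cases t)
      (simp_all add: tensor_def extend2_add_scale lookup_add lookup_basis)
qed (simp_all add: tensor_def extend2_add_scale lookup_add distrib_right)

lemma tensor_simps:
  "tensor (x + x') y = tensor x y + tensor x' y"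
  "tensor x (y + y') = tensor x y + tensor x y'"
  "tensor (x - x') y = tensor x y - tensor x' y"
  "tensor x (y - y') = tensor x y - tensor x y'"
  "tensor (- x) y = - tensor x y"
  "tensor x (- y) = - tensor x y"
  "tensor (scale c x) y = scale c (tensor x y)"
  "tensor x (scale c y) = scale c (tensor x y)"
  "tensor 0 y = 0"
  "tensor x 0 = 0"
  by (rule poly_mapping_eqI, simp add: lookup_tensor lookup_add lookup_minus algebra_simps)+

lemma tensor_basis [simp]: "tensor (basis a) (basis b) = basis (a, b)"
  by (simp add: tensor_def)

lemma ksign_simps [simp]: "ksign 0 = 1" "ksign 1 = - 1"
  by (simp_all add: ksign_def)

section \<open>Coboundaries on Lie superalgebras\<close>

lemma super_twist_simps:
  "super_twist p (x + y) = super_twist p x + super_twist p y"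
  "super_twist p (scale c x) = scale c (super_twist p x)"
  "super_twist p (x - y) = super_twist p x - super_twist p y"
  "super_twist p (- x) = - super_twist p x"
  "super_twist p 0 = 0"
  by (simp_all add: super_twist_def extend_simps)

lemma super_twist_tensor:
  assumes "u \<in> homogeneous p i" "v \<in> homogeneous p j"
  shows "super_twist p (tensor u v) = scale (ksign (i * j)) (tensor v u)"
  using assms(1)
proof (rule homogeneous_induct)
  fix a assume a: "p a = i"
  show "super_twist p (tensor (basis a) v) = scale (ksign (i * j)) (tensor v (basis a))"
    using assms(2) by (rule homogeneous_induct)
      (simp_all add: a super_twist_def tensor_simps extend_simps cvec.scale_right_distrib mult.commute)
qed (simp_all add: super_twist_def tensor_simps extend_simps cvec.scale_right_distrib mult.commute)

lemma super_twist_involutive: "super_twist p (super_twist p t) = t"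
proof (rule cvec_induct[of _ t])
  fix ab :: "'a \<times> 'a"
  show "super_twist p (super_twist p (basis ab)) = basis ab"
    by (cases ab) (simp add: super_twist_def extend_simps mult.commute)
qed (simp_all add: super_twist_def extend_simps)

text \<open>Since \<tau> is an involution and 2 is invertible, the image of
  \<open>1 - \<tau>\<close> is the (-1)-eigenspace of \<tau>; a preimage of \<open>t\<close> is
  \<open>t / 2\<close>.\<close>

lemma im_one_minus_twist_iff: "t \<in> im_one_minus_twist p \<longleftrightarrow> super_twist p t = - t"
proof
  assume "t \<in> im_one_minus_twist p"
  then obtain s where "t = s - super_twist p s" unfolding im_one_minus_twist_def by blast
  then have "super_twist p t = super_twist p s - super_twist p (super_twist p s)"
    by (simp add: super_twist_def extend_simps)
  then show "super_twist p t = - t"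
    unfolding super_twist_involutive using \<open>t = s - super_twist p s\<close> by simp
next
  assume t: "super_twist p t = - t"
  have "scale (1/2) t - super_twist p (scale (1/2) t) = scale (1/2) (t - super_twist p t)"
    by (simp add: super_twist_def extend_simps cvec.scale_right_diff_distrib)
  also have "\<dots> = t"
    unfolding t by (rule poly_mapping_eqI) (simp add: lookup_add)
  finally show "t \<in> im_one_minus_twist p"
    unfolding im_one_minus_twist_def by (metis rangeI)
qed

lemma super_cyclic_tensor:
  assumes "u \<in> homogeneous p i" "v \<in> homogeneous p j" "w \<in> homogeneous p k"
  shows "super_cyclic p (tensor u (tensor v w)) = scale (ksign (i * (j + k))) (tensor v (tensor w u))"
  using assms(1)
proof (rule homogeneous_induct)
  fix a assume a: "p a = i"
  show "super_cyclic p (tensor (basis a) (tensor v w))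
      = scale (ksign (i * (j + k))) (tensor v (tensor w (basis a)))"
    using assms(2)
  proof (rule homogeneous_induct)
    fix b assume b: "p b = j"
    show "super_cyclic p (tensor (basis a) (tensor (basis b) w))
        = scale (ksign (i * (j + k))) (tensor (basis b) (tensor w (basis a)))"
      using assms(3) by (rule homogeneous_induct)
        (simp_all add: a b super_cyclic_def tensor_simps extend_simps cvec.scale_right_distrib
            mult.commute)
  qed (simp_all add: super_cyclic_def tensor_simps extend_simps cvec.scale_right_distrib mult.commute)
qed (simp_all add: super_cyclic_def tensor_simps extend_simps cvec.scale_right_distrib mult.commute)

section \<open>Double sums over two copies of \<open>r\<close>\<close>

text \<open>Both \<open>c(r)\<close> and \<open>(1 \<otimes> \<Delta>) \<Delta> e\<close> are
  quadratic in \<open>r\<close> and have this shape, so comparing them reduces to comparing summands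
  after renaming indices.\<close>

definition quad_sum :: "('a \<times> 'a) cvec \<Rightarrow> ('a \<Rightarrow> 'a \<Rightarrow> 'a \<Rightarrow> 'a \<Rightarrow> 'c cvec) \<Rightarrow> 'c cvec" where
  "quad_sum r F = extend (\<lambda>(a, b). extend (\<lambda>(c, d). F a b c d) r) r"

lemma quad_sum_simps:
  "quad_sum r (\<lambda>a b c d. F a b c d + G a b c d) = quad_sum r F + quad_sum r G"
  "quad_sum r (\<lambda>a b c d. F a b c d - G a b c d) = quad_sum r F - quad_sum r G"
  by (simp_all add: quad_sum_def extend_fun_simps[symmetric] case_prod_unfold)

lemma linear_quad_sum:
  assumes "linear_map f"
  shows "f (quad_sum r F) = quad_sum r (\<lambda>a b c d. f (F a b c d))"
  by (simp add: quad_sum_def linear_extend[OF assms] case_prod_unfold)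

text \<open>Evenness of \<open>r\<close> forces \<open>p a + p b = 0\<close> on its support, so only
  pairs of equal parity contribute.\<close>

lemma quad_sum_in_span:
  assumes "r \<in> homogeneous (parity2 p) 0"
    and "\<And>a b c d. p b = p a \<Longrightarrow> p d = p c \<Longrightarrow> F a b c d \<in> cvec.span S"
  shows "quad_sum r F \<in> cvec.span S"
proof -
  have *: "p b = p a" if "Poly_Mapping.lookup r (a, b) \<noteq> 0" for a b
  proof -
    have "p a + p b = 0" using assms(1) that by (auto simp: homogeneous_iff parity2_def)
    then show ?thesis by (cases "p a"; cases "p b") auto
  qed
  show ?thesis
    unfolding quad_sum_def
    by (rule extend_in_span, clarify, rule extend_in_span, clarify, rule assms(2)) (auto intro: *)
qed

lemma quad_sum_cong:
  assumes "r \<in> homogeneous (parity2 p) 0"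
    and "\<And>a b c d. p b = p a \<Longrightarrow> p d = p c \<Longrightarrow> F a b c d = G a b c d"
  shows "quad_sum r F = quad_sum r G"
proof -
  \<comment> \<open>The span of the empty set is zero, so this membership is the desired
    equality.\<close>
  have "quad_sum r (\<lambda>a b c d. F a b c d - G a b c d) \<in> cvec.span {}"
    using assms(1) by (rule quad_sum_in_span) (simp add: assms(2))
  then show ?thesis by (simp add: quad_sum_simps)
qed

lemma extend_swap: "extend (\<lambda>a. extend (\<lambda>b. f a b) y) x = extend (\<lambda>b. extend (\<lambda>a. f a b) x) y"
  unfolding extend_def cvec.scale_sum_right
  by (subst sum.swap) (simp add: mult.commute)

lemma quad_sum_swap: "quad_sum r F = quad_sum r (\<lambda>a b c d. F c d a b)"
  unfolding quad_sum_def case_prod_unfold by (rule extend_swap)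

text \<open>Substituting \<open>r = - \<tau> r\<close> into one copy exchanges its two entries; the
  sign of the twist depends on \<open>p a\<close> alone because \<open>p b = p a\<close> on the
  support.\<close>

lemma quad_sum_flip:
  assumes "r \<in> homogeneous (parity2 p) 0" "super_twist p r = - r"
  shows "quad_sum r F = quad_sum r (\<lambda>a b c d. - scale (ksign (p a)) (F b a c d))"
    and "quad_sum r F = quad_sum r (\<lambda>a b c d. - scale (ksign (p c)) (F a b d c))"
proof -
  have *: "quad_sum r F = quad_sum r (\<lambda>a b c d. - scale (ksign (p a)) (F b a c d))" for F :: "'a \<Rightarrow>
      'a \<Rightarrow> 'a \<Rightarrow> 'a \<Rightarrow> 'c cvec"
  proof -
    define f where "f = (\<lambda>(a, b). extend (\<lambda>(c, d). F a b c d) r)"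
    have "extend f r = - extend f (super_twist p r)"
      by (simp add: assms(2) extend_simps)
    also have "\<dots> = extend (\<lambda>(a, b). - scale (ksign (p a * p b)) (f (b, a))) r"
      unfolding super_twist_def linear_extend[OF extend_linear]
      by (simp add: extend_fun_simps(3)[symmetric] case_prod_unfold extend_simps)
    also have "\<dots> = quad_sum r (\<lambda>a b c d. - scale (ksign (p a * p b)) (F b a c d))"
      unfolding quad_sum_def f_def
      by (simp add: case_prod_unfold extend_fun_simps)
    also have "\<dots> = quad_sum r (\<lambda>a b c d. - scale (ksign (p a)) (F b a c d))"
      using assms(1)
    proof (rule quad_sum_cong)
      fix a b c d assume "p b = p a"
      then show "- scale (ksign (p a * p b)) (F b a c d) = - scale (ksign (p a)) (F b a c d)"
        by (cases "p a") simp_all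
    qed
    finally show ?thesis by (simp add: quad_sum_def f_def)
  qed
  show "quad_sum r F = quad_sum r (\<lambda>a b c d. - scale (ksign (p a)) (F b a c d))"
    by (rule *)
  \<comment> \<open>Conjugating with the exchange of the two copies carries the rule to the second
    copy.\<close>
  have "quad_sum r F = quad_sum r (\<lambda>a b c d. - scale (ksign (p a)) (F c d b a))"
    by (subst quad_sum_swap) (rule *)
  also have "\<dots> = quad_sum r (\<lambda>a b c d. - scale (ksign (p c)) (F a b d c))"
    by (rule quad_sum_swap)
  finally show "quad_sum r F = quad_sum r (\<lambda>a b c d. - scale (ksign (p c)) (F a b d c))" .
qed

section \<open>Actions on tensor powers and the Yang-Baxter element\<close>

text \<open>The adjoint diagonal action on the triple tensor product; triples are nested pairs,
  hence the recursion through \<open>diag_action\<close>.\<close>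

definition diag_action3 ::
  "('b \<Rightarrow> bit) \<Rightarrow> ('b cvec \<Rightarrow> 'b cvec \<Rightarrow> 'b cvec) \<Rightarrow> 'b \<Rightarrow> ('b \<times> 'b \<times> 'b) cvec \<Rightarrow> ('b \<times> 'b \<times> 'b) cvec" where
  "diag_action3 p br x = extend (\<lambda>(a, t). tensor (br (basis x) (basis a)) (basis t)
     + scale (ksign (p x * p a)) (tensor (basis a) (diag_action p br (basis x) (basis t))))"

text \<open>For even \<open>r\<close> this is \<open>c(r)\<close>, as an element of the triple tensor product of the Lie superalgebra.\<close>

definition yang_baxter :: "('b \<Rightarrow> bit) \<Rightarrow> ('b cvec \<Rightarrow> 'b cvec \<Rightarrow> 'b cvec) \<Rightarrow> ('b \<times> 'b) cvec \<Rightarrow> ('b \<times> 'b \<times>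
    'b) cvec" where
  "yang_baxter p br r = quad_sum r (\<lambda>a b c d.
     scale (ksign (p a * p c)) (tensor (br (basis a) (basis c)) (tensor (basis b) (basis d)))
     + tensor (basis a) (tensor (br (basis b) (basis c)) (basis d))
     + scale (ksign (p a * p c)) (tensor (basis a) (tensor (basis c) (br (basis b) (basis d)))))"

lemma tensor_linear: "linear_map (tensor x)"
  by (simp add: linear_map_iff tensor_simps)

lemma diag_action_linear:
  "linear_map (diag_action p br x)" "linear_map (\<lambda>x. diag_action p br x t)"
  unfolding diag_action_def by (rule extend2_linear)+

lemma diag_action_simps:
  "diag_action p br (x + y) t = diag_action p br x t + diag_action p br y t"
  "diag_action p br x (t + s) = diag_action p br x t + diag_action p br x s"
  "diag_action p br x (t - s) = diag_action p br x t - diag_action p br x s"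
  "diag_action p br x (- t) = - diag_action p br x t"
  "diag_action p br (scale c x) t = scale c (diag_action p br x t)"
  "diag_action p br x (scale c t) = scale c (diag_action p br x t)"
  "diag_action p br 0 t = 0"
  "diag_action p br x 0 = 0"
proof -
  interpret l: Vector_Spaces.linear scale scale "diag_action p br x" by (rule diag_action_linear)
  interpret r: Vector_Spaces.linear scale scale "\<lambda>x. diag_action p br x t" by (rule diag_action_linear)
  show "diag_action p br (x + y) t = diag_action p br x t + diag_action p br y t"
    "diag_action p br (scale c x) t = scale c (diag_action p br x t)" "diag_action p br 0 t = 0"
    by (rule r.add r.scale r.zero)+
  show "diag_action p br x (t + s) = diag_action p br x t + diag_action p br x s"
    "diag_action p br x (t - s) = diag_action p br x t - diag_action p br x s"
    "diag_action p br x (- t) = - diag_action p br x t"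
    "diag_action p br x (scale c t) = scale c (diag_action p br x t)"
    "diag_action p br x 0 = 0"
    by (rule l.add l.diff l.neg l.scale l.zero)+
qed

lemma coboundary_even:
  assumes "r \<in> homogeneous (parity2 p) 0"
  shows "coboundary p br r = (\<lambda>x. diag_action p br x r)"
proof (rule linear_map_eqI)
  show "linear_map (coboundary p br r)" unfolding coboundary_def by (rule extend2_linear)
  show "linear_map (\<lambda>x. diag_action p br x r)" by (rule diag_action_linear)
  show "coboundary p br r (basis a) = diag_action p br (basis a) r" for a
    using coboundary_homogeneous[OF assms, of "basis a" "p a"] by (simp add: homogeneous_closed)
qed

section \<open>Tensor squares as modules over a Lie superalgebra\<close>

locale lie_superalg =
  fixes p :: "'b \<Rightarrow> bit" and br :: "'b cvec \<Rightarrow> 'b cvec \<Rightarrow> 'b cvec"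
  assumes lie: "lie_superalgebra p br"
begin

lemma br_linear: "linear_map (br x)" "linear_map (\<lambda>x. br x y)"
  using lie by (auto simp: lie_superalgebra_def)

lemma br_simps:
  "br (x + y) z = br x z + br y z"
  "br z (x + y) = br z x + br z y"
  "br (scale c x) z = scale c (br x z)"
  "br z (scale c x) = scale c (br z x)"
  "br (x - y) z = br x z - br y z"
  "br z (x - y) = br z x - br z y"
  "br (- x) z = - br x z"
  "br z (- x) = - br z x"
  "br 0 z = 0"
  "br z 0 = 0"
proof -
  interpret l: Vector_Spaces.linear scale scale "br z" by (rule br_linear)
  interpret r: Vector_Spaces.linear scale scale "\<lambda>x. br x z" by (rule br_linear)
  show  "br (x + y) z = br x z + br y z" "br z (x + y) = br z x + br z y"
  "br (scale c x) z = scale c (br x z)" "br z (scale c x) = scale c (br z x)"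
  "br (x - y) z = br x z - br y z" "br z (x - y) = br z x - br z y"
  "br (- x) z = - br x z" "br z (- x) = - br z x" "br 0 z = 0" "br z 0 = 0"
  by (simp_all only: l.add r.add l.scale r.scale l.diff r.diff l.neg r.neg l.zero r.zero)
qed

lemma br_homogeneous: "x \<in> homogeneous p i \<Longrightarrow> y \<in> homogeneous p j \<Longrightarrow> br x y \<in> homogeneous p (i + j)"
  using lie unfolding lie_superalgebra_def by blast

lemma br_skew: "x \<in> homogeneous p i \<Longrightarrow> y \<in> homogeneous p j \<Longrightarrow> br x y = - scale (ksign (i * j)) (br y x)"
  using lie unfolding lie_superalgebra_def by blast

lemma br_jacobi: "x \<in> homogeneous p i \<Longrightarrow> y \<in> homogeneous p j \<Longrightarrow>
    br x (br y z) = br (br x y) z + scale (ksign (i * j)) (br y (br x z))"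
  using lie unfolding lie_superalgebra_def by blast

abbreviation act :: "'b cvec \<Rightarrow> ('b \<times> 'b) cvec \<Rightarrow> ('b \<times> 'b) cvec" where
  "act \<equiv> diag_action p br"

lemma basis_homogeneous: "basis a \<in> homogeneous p (p a)"
  by (simp add: homogeneous_closed)

lemma act_tensor:
  assumes "x \<in> homogeneous p i" "u \<in> homogeneous p k"
  shows "act x (tensor u v) = tensor (br x u) v + scale (ksign (i * k)) (tensor u (br x v))"
  using assms(1)
proof (rule homogeneous_induct)
  fix a assume a: "p a = i"
  show "act (basis a) (tensor u v)
      = tensor (br (basis a) u) v + scale (ksign (i * k)) (tensor u (br (basis a) v))"
    using assms(2)
  proof (rule homogeneous_induct)
    fix b assume b: "p b = k"
    show "act (basis a) (tensor (basis b) v)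
        = tensor (br (basis a) (basis b)) v + scale (ksign (i * k)) (tensor (basis b) (br (basis a) v))"
    proof (rule cvec_induct[of _ v])
      fix c
      show "act (basis a) (tensor (basis b) (basis c)) = tensor (br (basis a) (basis b)) (basis c)
          + scale (ksign (i * k)) (tensor (basis b) (br (basis a) (basis c)))"
        by (simp add: a b diag_action_def)
    qed (simp_all add: tensor_simps diag_action_simps br_simps cvec.scale_right_distrib mult.commute)
  qed (simp_all add: tensor_simps diag_action_simps br_simps cvec.scale_right_distrib mult.commute)
qed (simp_all add: tensor_simps diag_action_simps br_simps cvec.scale_right_distrib mult.commute)

text \<open>The super Jacobi identity handles each tensor factor, and the mixed terms cancel by the
  sign rule. This is what makes coboundaries cocycles.\<close>

lemma act_br:
  assumes "x \<in> homogeneous p i" "y \<in> homogeneous p j"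
  shows "act (br x y) t = act x (act y t) - scale (ksign (i * j)) (act y (act x t))"
proof (rule cvec_induct[of _ t])
  fix ab :: "'b \<times> 'b"
  obtain a b where ab: "ab = (a, b)" by (cases ab)
  note [simp] = act_tensor[OF assms(1) basis_homogeneous] act_tensor[OF assms(2) basis_homogeneous]
    act_tensor[OF assms(1) br_homogeneous[OF assms(2) basis_homogeneous]]
    act_tensor[OF assms(2) br_homogeneous[OF assms(1) basis_homogeneous]]
    act_tensor[OF br_homogeneous[OF assms] basis_homogeneous]
  have j: "br (br x y) z = br x (br y z) - scale (ksign (i * j)) (br y (br x z))" for z
    using br_jacobi[OF assms] by (simp add: algebra_simps)
  show "act (br x y) (basis ab) = act x (act y (basis ab)) - scale (ksign (i * j)) (act y (act x
      (basis ab)))"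
    unfolding ab tensor_basis[symmetric]
    by (cases i; cases j; cases "p a")
      (simp_all add: j tensor_simps diag_action_simps cvec.scale_right_distrib del: tensor_basis)
qed (simp_all add: diag_action_simps cvec.scale_right_distrib cvec.scale_right_diff_distrib mult.commute)

text \<open>The signs on both sides agree for every choice of parities, so \<tau> is a module
  homomorphism. This transfers the skew-symmetry of \<open>\<Delta>\<close> to
  \<open>r\<close>.\<close>

lemma super_twist_act:
  assumes "x \<in> homogeneous p i"
  shows "super_twist p (act x t) = act x (super_twist p t)"
proof (rule cvec_induct[of _ t])
  fix ab :: "'b \<times> 'b"
  obtain a b where ab: "ab = (a, b)" by (cases ab)
  note [simp] = act_tensor[OF assms basis_homogeneous]
    super_twist_tensor[OF basis_homogeneous basis_homogeneous]
    super_twist_tensor[OF basis_homogeneous br_homogeneous[OF assms basis_homogeneous]]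
    super_twist_tensor[OF br_homogeneous[OF assms basis_homogeneous] basis_homogeneous]
  show "super_twist p (act x (basis ab)) = act x (super_twist p (basis ab))"
    unfolding ab tensor_basis[symmetric]
    by (cases i; cases "p a"; cases "p b")
      (simp_all add: super_twist_simps diag_action_simps cvec.scale_right_distrib del: tensor_basis)
qed (simp_all add: super_twist_simps diag_action_simps)

end

lemma id_tensor_tensor:
  assumes "linear_map D"
  shows "id_tensor D (tensor u v) = tensor u (D v)"
proof -
  have D: "D (x + y) = D x + D y" "D (scale c x) = scale c (D x)" "D 0 = 0" for x y c
    using assms unfolding linear_map_iff by (metis cvec.scale_zero_left)+
  show ?thesis
  proof (rule cvec_induct[of _ u])
    fix a
    show "id_tensor D (tensor (basis a) v) = tensor (basis a) (D v)"
      by (rule cvec_induct[of _ v]) (simp_all add: id_tensor_def tensor_simps extend_simps D)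
  qed (simp_all add: id_tensor_def tensor_simps extend_simps)
qed

lemma super_cyclic_linear: "linear_map (super_cyclic p)"
  unfolding super_cyclic_def by (rule extend_linear)

section \<open>The co-Jacobi identity and the classical Yang-Baxter equation\<close>

context lie_superalg
begin

lemma diag_action3_tensor:
  "diag_action3 p br e (tensor (basis a) t)
     = tensor (br (basis e) (basis a)) t + scale (ksign (p e * p a)) (tensor (basis a) (act (basis
         e) t))"
  by (rule cvec_induct[of _ t])
    (simp_all add: diag_action3_def tensor_simps extend_simps diag_action_simps
        cvec.scale_right_distrib mult.commute)

lemma diag_action3_tensor':
  assumes "u \<in> homogeneous p i"
  shows "diag_action3 p br e (tensor u t)
     = tensor (br (basis e) u) t + scale (ksign (p e * i)) (tensor u (act (basis e) t))"
  using assms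
proof (rule homogeneous_induct)
  fix a assume "p a = i"
  then show "diag_action3 p br e (tensor (basis a) t)
     = tensor (br (basis e) (basis a)) t + scale (ksign (p e * i)) (tensor (basis a) (act (basis e) t))"
    using diag_action3_tensor by simp
qed (simp_all add: diag_action3_def tensor_simps extend_simps diag_action_simps br_simps
    cvec.scale_right_distrib mult.commute)

lemma diag_action3_linear: "linear_map (diag_action3 p br e)"
  unfolding diag_action3_def by (rule extend_linear)

text \<open>Three composite reindexings: flip the first copy of \<open>r\<close> and exchange the
  copies, flip the second copy and exchange, or flip both.\<close>

lemma
  assumes r: "r \<in> homogeneous (parity2 p) 0" "super_twist p r = - r"
  shows quad_sum_eq_flip1_swap: "(\<And>a b c d. p b = p a \<Longrightarrow> p d = p c \<Longrightarrow> G a b c d = - scale (ksign (p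
      c)) (F d c a b)) \<Longrightarrow> quad_sum r F = quad_sum r G"
    and quad_sum_eq_swap_flip2: "(\<And>a b c d. p b = p a \<Longrightarrow> p d = p c \<Longrightarrow> G a b c d = - scale (ksign (p
        a)) (F c d b a)) \<Longrightarrow> quad_sum r F = quad_sum r G"
    and quad_sum_eq_flips: "(\<And>a b c d. p b = p a \<Longrightarrow> p d = p c \<Longrightarrow> G a b c d = scale (ksign (p a + p c))
        (F b a d c)) \<Longrightarrow> quad_sum r F = quad_sum r G"
proof -
  note flip1 = quad_sum_flip(1)[OF r] and flip2 = quad_sum_flip(2)[OF r]
  show "quad_sum r F = quad_sum r G" if "\<And>a b c d. p b = p a \<Longrightarrow> p d = p c \<Longrightarrow> G a b c d = - scale
      (ksign (p c)) (F d c a b)"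
    by (rule trans[OF flip1], rule trans[OF quad_sum_swap], rule quad_sum_cong[OF r(1)]) (simp add: that)
  show "quad_sum r F = quad_sum r G" if "\<And>a b c d. p b = p a \<Longrightarrow> p d = p c \<Longrightarrow> G a b c d = - scale
      (ksign (p a)) (F c d b a)"
    by (rule trans[OF flip2], rule trans[OF quad_sum_swap], rule quad_sum_cong[OF r(1)]) (simp add: that)
  show "quad_sum r F = quad_sum r G" if "\<And>a b c d. p b = p a \<Longrightarrow> p d = p c \<Longrightarrow> G a b c d = scale (ksign
      (p a + p c)) (F b a d c)"
  proof (rule trans[OF flip1], rule trans[OF flip2], rule quad_sum_cong[OF r(1)])
    fix a b c d assume "p b = p a" "p d = p c"
    then show "- scale (ksign (p c)) (- scale (ksign (p a)) (F b a d c)) = G a b c d"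
      by (cases "p a"; cases "p c") (simp_all add: that)
  qed
qed

text \<open>
  Applying the powers of \<open>\<xi>\<close> to the four summands \<open>l1\<close>, \<dots>, \<open>l4\<close> of \<open>(1 \<otimes> \<Delta>) \<Delta> e\<close> gives twelve sums,
  and the Jacobi identity splits \<open>e \<cdot> c(r)\<close> into twelve sums: \<open>l1\<close>, \<dots>, \<open>l4\<close>
  and the eight sums \<open>m\<close>. They agree one by one after interchanging the two copies of \<open>r\<close> and applying \<open>\<tau> r = - r\<close> to them.
\<close>

lemma co_jacobi_eq_action_yang_baxter:
  assumes r: "r \<in> homogeneous (parity2 p) 0" "super_twist p r = - r"
    and t_def: "t = id_tensor (\<lambda>x. act x r) (act (basis e) r)"
  shows "t + super_cyclic p t + super_cyclic p (super_cyclic p t) = diag_action3 p br e (yang_baxter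
      p br r)"
proof -
  define X where "X a = br (basis e) (basis a)" for a :: 'b
  define B where "B a b = br (basis a) (basis b)" for a b :: 'b
  define XB where "XB a b = br (X a) (basis b)" for a b :: 'b
  define BX where "BX a b = br (basis a) (X b)" for a b :: 'b
  define k where "k = p e"
  have hX [simp]: "X a \<in> homogeneous p (k + p a)" for a
    unfolding X_def k_def by (intro br_homogeneous basis_homogeneous)
  have hB [simp]: "B a b \<in> homogeneous p (p a + p b)" for a b
    unfolding B_def by (intro br_homogeneous basis_homogeneous)
  have hXB [simp]: "XB a b \<in> homogeneous p (k + p a + p b)" for a b
    unfolding XB_def by (intro br_homogeneous hX basis_homogeneous)
  have B_skew: "B a b = - scale (ksign (p a * p b)) (B b a)" for a b
    unfolding B_def by (intro br_skew basis_homogeneous)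
  have BX_skew: "BX a b = - scale (ksign (p a * (k + p b))) (XB b a)" for a b
    unfolding XB_def BX_def by (intro br_skew basis_homogeneous hX)
  have XB_jacobi: "br (basis e) (B a b) = XB a b + scale (ksign (k * p a)) (BX a b)" for a b
    unfolding B_def XB_def BX_def X_def k_def by (intro br_jacobi basis_homogeneous)

  \<comment> \<open>In \<open>l1\<close> and \<open>l2\<close> the element \<open>e\<close> acts on
    \<open>a\<close>, in \<open>l3\<close> and \<open>l4\<close> on \<open>b\<close>; the resulting
    second slot then acts on \<open>c\<close> or on \<open>d\<close>.\<close>
  define l1 where "l1 a b c d = tensor (X a) (tensor (B b c) (basis d))" for a b c d :: 'b
  define l2 where "l2 a b c d = scale (ksign (p a * p c)) (tensor (X a) (tensor (basis c) (B b d)))"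
      for a b c d :: 'b
  define l3 where "l3 a b c d = scale (ksign (k * p a)) (tensor (basis a) (tensor (XB b c) (basis
      d)))" for a b c d :: 'b
  define l4 where "l4 a b c d = scale (ksign (k * p a + k * p c + p a * p c)) (tensor (basis a)
      (tensor (basis c) (XB b d)))" for a b c d :: 'b
  define Z where "Z F = (\<lambda>a b c d. super_cyclic p (F a b c d))" for F :: "'b \<Rightarrow> 'b \<Rightarrow> 'b \<Rightarrow> 'b \<Rightarrow> ('b \<times>
      'b \<times> 'b) cvec"
  \<comment> \<open>The numbers are positions in the expansion of \<open>e \<cdot> c(r)\<close>; the
    missing 5, 6, 9, 11 are \<open>l1\<close>, \<open>l3\<close>, \<open>l2\<close>,
    \<open>l4\<close>.\<close>
  define m1 where "m1 a b c d = scale (ksign (p a * p c)) (tensor (XB a c) (tensor (basis b) (basis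
      d)))" for a b c d :: 'b
  define m2 where "m2 a b c d = scale (ksign (p a * p c + k * p a)) (tensor (BX a c) (tensor (basis
      b) (basis d)))" for a b c d :: 'b
  define m3 where "m3 a b c d = scale (ksign (p a * p c + k * (p a + p c))) (tensor (B a c) (tensor
      (X b) (basis d)))" for a b c d :: 'b
  define m4 where "m4 a b c d = scale (ksign (p a * p c + k * p c)) (tensor (B a c) (tensor (basis
      b) (X d)))" for a b c d :: 'b
  define m7 where "m7 a b c d = tensor (basis a) (tensor (BX b c) (basis d))" for a b c d :: 'b
  define m8 where "m8 a b c d = scale (ksign (k * p c)) (tensor (basis a) (tensor (B b c) (X d)))"
      for a b c d :: 'b
  define m10 where "m10 a b c d = scale (ksign (p a * p c + k * p a)) (tensor (basis a) (tensor (X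
      c) (B b d)))" for a b c d :: 'b
  define m12 where "m12 a b c d = scale (ksign (p a * p c + k * p c)) (tensor (basis a) (tensor
      (basis c) (BX b d)))" for a b c d :: 'b
  note ms = l1_def l2_def l3_def l4_def m1_def m2_def m3_def m4_def m7_def m8_def m10_def m12_def

  have t: "t = quad_sum r (\<lambda>a b c d. l1 a b c d + l2 a b c d + (l3 a b c d + l4 a b c d))"
  proof -
    have act_extend: "act v r = extend (\<lambda>t. act v (basis t)) r" for v
    proof -
      have "extend basis r = r"
        by (rule cvec_induct[of _ r]) (simp_all add: extend_simps)
      then show ?thesis
        by (metis linear_extend[OF diag_action_linear(1)])
    qed
    have idt: "id_tensor (\<lambda>x. act x r) (tensor u v) = extend (\<lambda>t. tensor u (act v (basis t))) r" for u v
      by (subst id_tensor_tensor[OF diag_action_linear(2)], subst act_extend, rule linear_extend[OF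
          tensor_linear])
    have idl: "linear_map (id_tensor (\<lambda>x. act x r))"
      unfolding id_tensor_def by (rule extend_linear)
    then have idl': "id_tensor (\<lambda>x. act x r) (x + scale c y)
        = id_tensor (\<lambda>x. act x r) x + scale c (id_tensor (\<lambda>x. act x r) y)" for x c y
      unfolding linear_map_iff by simp
    have "t = extend (\<lambda>ab. id_tensor (\<lambda>x. act x r) (act (basis e) (basis ab))) r"
      unfolding t_def by (subst (2) act_extend) (rule linear_extend[OF idl])
    also have "\<dots> = quad_sum r (\<lambda>a b c d. tensor (X a) (act (basis b) (basis (c, d)))
        + scale (ksign (k * p a)) (tensor (basis a) (act (X b) (basis (c, d)))))"
      unfolding quad_sum_def
    proof (rule extend_cong)
      fix ab :: "'b \<times> 'b"
      obtain a b where ab: "ab = (a, b)" by (cases ab)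
      have "id_tensor (\<lambda>x. act x r) (act (basis e) (tensor (basis a) (basis b)))
        = extend (\<lambda>t. tensor (X a) (act (basis b) (basis t))) r
          + scale (ksign (k * p a)) (extend (\<lambda>t. tensor (basis a) (act (X b) (basis t))) r)"
        unfolding act_tensor[OF basis_homogeneous basis_homogeneous] idl' idt X_def k_def ..
      then show "id_tensor (\<lambda>x. act x r) (act (basis e) (basis ab)) = (case ab of (a, b) \<Rightarrow> extend
          (\<lambda>(c, d). tensor (X a) (act (basis b) (basis (c, d)))
            + scale (ksign (k * p a)) (tensor (basis a) (act (X b) (basis (c, d))))) r)"
        by (simp add: ab case_prod_unfold extend_fun_simps)
    qed
    also have "\<dots> = quad_sum r (\<lambda>a b c d. l1 a b c d + l2 a b c d + (l3 a b c d + l4 a b c d))"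
    proof (rule quad_sum_cong[OF r(1)])
      fix a b c d assume pp: "p b = p a" "p d = p c"
      show "tensor (X a) (act (basis b) (basis (c, d)))
        + scale (ksign (k * p a)) (tensor (basis a) (act (X b) (basis (c, d))))
        = l1 a b c d + l2 a b c d + (l3 a b c d + l4 a b c d)"
        unfolding tensor_basis[symmetric] act_tensor[OF basis_homogeneous basis_homogeneous]
          act_tensor[OF hX basis_homogeneous] ms
        by (cases "p a"; cases "p c"; cases k) (simp_all add: pp tensor_simps B_def XB_def
            cvec.scale_right_distrib del: tensor_basis)
    qed
    finally show ?thesis .
  qed
  have Zt: "super_cyclic p (quad_sum r F) = quad_sum r (Z F)" for F
    unfolding Z_def by (rule linear_quad_sum[OF super_cyclic_linear])
  have Zadd: "Z (\<lambda>a b c d. F a b c d + G a b c d) = (\<lambda>a b c d. Z F a b c d + Z G a b c d)" for F G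
    unfolding Z_def super_cyclic_def by (simp add: extend_simps)
  have Zs: "super_cyclic p (scale c x) = scale c (super_cyclic p x)" "super_cyclic p (- x) = -
      super_cyclic p x" for c x
    unfolding super_cyclic_def by (simp_all add: extend_simps)
  note cyc [simp] = super_cyclic_tensor[OF hX hB basis_homogeneous] super_cyclic_tensor[OF hX
      basis_homogeneous hB]
    super_cyclic_tensor[OF hB basis_homogeneous hX] super_cyclic_tensor[OF basis_homogeneous hX hB]
    super_cyclic_tensor[OF basis_homogeneous hB hX] super_cyclic_tensor[OF hB hX basis_homogeneous]
    super_cyclic_tensor[OF basis_homogeneous basis_homogeneous hXB]
    super_cyclic_tensor[OF basis_homogeneous hXB basis_homogeneous]
    super_cyclic_tensor[OF hXB basis_homogeneous basis_homogeneous]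
  \<comment> \<open>Each label names the target \<open>m\<close>. The reindexing is the one that
    puts the rotated factors into the order of the target; a reversed bracket is repaired by
    skew-symmetry.\<close>
  have e4: "quad_sum r (Z l1) = quad_sum r m4"
  proof (rule quad_sum_eq_flip1_swap[OF r])
    fix a b c d assume pp: "p b = p a" "p d = p c"
    show "m4 a b c d = - scale (ksign (p c)) ((Z l1) d c a b)"
      using B_skew[of c a] unfolding Z_def ms
      by (cases "p a"; cases "p c"; cases k) (simp_all add: pp tensor_simps Zs del: tensor_basis)
  qed
  have e10: "quad_sum r (Z (Z l1)) = quad_sum r m10"
  proof (rule quad_sum_eq_swap_flip2[OF r])
    fix a b c d assume pp: "p b = p a" "p d = p c"
    show "m10 a b c d = - scale (ksign (p a)) ((Z (Z l1)) c d b a)"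
      using B_skew[of d b] unfolding Z_def ms
      by (cases "p a"; cases "p c"; cases k) (simp_all add: pp tensor_simps Zs del: tensor_basis)
  qed
  have e8: "quad_sum r (Z l2) = quad_sum r m8"
  proof (rule quad_sum_eq_flip1_swap[OF r])
    fix a b c d assume pp: "p b = p a" "p d = p c"
    show "m8 a b c d = - scale (ksign (p c)) ((Z l2) d c a b)"
      using B_skew[of c b] unfolding Z_def ms
      by (cases "p a"; cases "p c"; cases k) (simp_all add: pp tensor_simps Zs del: tensor_basis)
  qed
  have e3: "quad_sum r (Z (Z l2)) = quad_sum r m3"
  proof (rule quad_sum_eq_flips[OF r])
    fix a b c d assume pp: "p b = p a" "p d = p c"
    show "m3 a b c d = scale (ksign (p a + p c)) ((Z (Z l2)) b a d c)"
      unfolding Z_def ms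
      by (cases "p a"; cases "p c"; cases k) (simp_all add: pp tensor_simps Zs del: tensor_basis)
  qed
  have e2: "quad_sum r (Z l3) = quad_sum r m2"
  proof (rule quad_sum_eq_flip1_swap[OF r])
    fix a b c d assume pp: "p b = p a" "p d = p c"
    show "m2 a b c d = - scale (ksign (p c)) ((Z l3) d c a b)"
      using BX_skew[of a c] unfolding Z_def ms
      by (cases "p a"; cases "p c"; cases k) (simp_all add: pp tensor_simps Zs del: tensor_basis)
  qed
  have e12: "quad_sum r (Z (Z l3)) = quad_sum r m12"
  proof (rule quad_sum_eq_swap_flip2[OF r])
    fix a b c d assume pp: "p b = p a" "p d = p c"
    show "m12 a b c d = - scale (ksign (p a)) ((Z (Z l3)) c d b a)"
      using BX_skew[of b d] unfolding Z_def ms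
      by (cases "p a"; cases "p c"; cases k) (simp_all add: pp tensor_simps Zs del: tensor_basis)
  qed
  have e7: "quad_sum r (Z l4) = quad_sum r m7"
  proof (rule quad_sum_eq_flip1_swap[OF r])
    fix a b c d assume pp: "p b = p a" "p d = p c"
    show "m7 a b c d = - scale (ksign (p c)) ((Z l4) d c a b)"
      using BX_skew[of b c] unfolding Z_def ms
      by (cases "p a"; cases "p c"; cases k) (simp_all add: pp tensor_simps Zs del: tensor_basis)
  qed
  have e1: "quad_sum r (Z (Z l4)) = quad_sum r m1"
  proof (rule quad_sum_eq_flips[OF r])
    fix a b c d assume pp: "p b = p a" "p d = p c"
    show "m1 a b c d = scale (ksign (p a + p c)) ((Z (Z l4)) b a d c)"
      unfolding Z_def ms
      by (cases "p a"; cases "p c"; cases k) (simp_all add: pp tensor_simps Zs del: tensor_basis)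
  qed
  have "diag_action3 p br e (yang_baxter p br r) = quad_sum r (\<lambda>a b c d. (m1 a b c d + m2 a b c d +
      m3 a b c d + m4 a b c d)
      + (l1 a b c d + (l3 a b c d + m7 a b c d) + m8 a b c d) + (l2 a b c d + m10 a b c d + (l4 a b
          c d + m12 a b c d)))"
    unfolding yang_baxter_def linear_quad_sum[OF diag_action3_linear]
  proof (rule quad_sum_cong[OF r(1)])
    fix a b c d assume pp: "p b = p a" "p d = p c"
    have lin: "diag_action3 p br e (x + y) = diag_action3 p br e x + diag_action3 p br e y"
      "diag_action3 p br e (scale c x) = scale c (diag_action3 p br e x)" for x y c
      using diag_action3_linear by (auto simp: linear_map_iff)
    have Be: "B e a = X a" for a by (simp add: B_def X_def)
    show "diag_action3 p br e (scale (ksign (p a * p c)) (tensor (br (basis a) (basis c)) (tensor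
        (basis b) (basis d)))
        + tensor (basis a) (tensor (br (basis b) (basis c)) (basis d))
        + scale (ksign (p a * p c)) (tensor (basis a) (tensor (basis c) (br (basis b) (basis d)))))
      = (m1 a b c d + m2 a b c d + m3 a b c d + m4 a b c d)
      + (l1 a b c d + (l3 a b c d + m7 a b c d) + m8 a b c d) + (l2 a b c d + m10 a b c d + (l4 a b
          c d + m12 a b c d))"
      unfolding lin B_def[symmetric] diag_action3_tensor'[OF hB] diag_action3_tensor'[OF
          basis_homogeneous]
        act_tensor[OF basis_homogeneous basis_homogeneous] act_tensor[OF basis_homogeneous hB]
        XB_jacobi X_def[symmetric] k_def[symmetric] ms
      by (cases "p a"; cases "p c"; cases k) (simp_all add: pp Be tensor_simps
          cvec.scale_right_distrib del: tensor_basis)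
  qed
  moreover have "t = quad_sum r l1 + quad_sum r l2 + (quad_sum r l3 + quad_sum r l4)"
    unfolding t quad_sum_simps ..
  moreover have "super_cyclic p t = quad_sum r m4 + quad_sum r m8 + (quad_sum r m2 + quad_sum r m7)"
    unfolding t Zt Zadd unfolding quad_sum_simps e4 e8 e2 e7 ..
  moreover have "super_cyclic p (super_cyclic p t) = quad_sum r m10 + quad_sum r m3 + (quad_sum r
      m12 + quad_sum r m1)"
    unfolding t Zt Zadd unfolding quad_sum_simps e10 e3 e12 e1 ..
  ultimately show ?thesis
    by (simp add: quad_sum_simps add_ac)
qed

text \<open>Two of \<open>r12\<close>, \<open>r13\<close>, \<open>r23\<close> share exactly one
  slot, and their supercommutator is, up to signs, a commutator of letters there. Modulo the
  enveloping ideal this is the Lie bracket.\<close>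

lemma cybe_elem_eq_yang_baxter:
  assumes r: "r \<in> homogeneous (parity2 p) 0"
  shows "cybe_elem p r - extend (\<lambda>(a, b, c). basis ([a], [b], [c])) (yang_baxter p br r) \<in>
      enveloping_kernel3 p br"
proof -
  let ?i = "extend (\<lambda>(a, b, c). basis ([a], [b], [c])) :: ('b \<times> 'b \<times> 'b) cvec \<Rightarrow> _"
  let ?w = "word_incl :: 'b cvec \<Rightarrow> _"
  have i_tensor: "?i (tensor u (tensor v w)) = tensor (?w u) (tensor (?w v) (?w w))" for u v w
  proof (rule cvec_induct[of _ u])
    fix a
    show "?i (tensor (basis a) (tensor v w)) = tensor (?w (basis a)) (tensor (?w v) (?w w))"
    proof (rule cvec_induct[of _ v])
      fix b
      show "?i (tensor (basis a) (tensor (basis b) w)) = tensor (?w (basis a)) (tensor (?w (basis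
          b)) (?w w))"
        by (rule cvec_induct[of _ w]) (simp_all add: tensor_simps extend_simps word_incl_def)
    qed (simp_all add: tensor_simps extend_simps word_incl_def)
  qed (simp_all add: tensor_simps extend_simps word_incl_def)
  \<comment> \<open>The ideal generator for two basis vectors, both outer factors being the empty
    word, that is, the unit.\<close>
  define g where "g a b = basis [a, b] - scale (ksign (p a * p b)) (basis [b, a]) - ?w (br (basis a)
      (basis b))" for a b
  have g: "g a b \<in> enveloping_ideal p br" for a b
  proof -
    have "g a b = word_mult (basis []) (word_mult
        (word_mult (?w (basis a)) (?w (basis b))
          - scale (ksign (p a * p b)) (word_mult (?w (basis b)) (?w (basis a)))
          - ?w (br (basis a) (basis b))) (basis []))"
    proof -
      have one: "word_mult (basis []) u = u" "word_mult u (basis []) = u" for u :: "'b list cvec"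
        by (rule cvec_induct[of _ u], simp_all add: word_mult_def extend2_add_scale)+
      show ?thesis unfolding one g_def by (simp add: word_incl_def word_mult_def)
    qed
    then show ?thesis
      unfolding enveloping_ideal_def using basis_homogeneous by (intro cvec.span_base) blast
  qed
  have ker: "tensor u (tensor v w) \<in> enveloping_kernel3 p br"
    if "u \<in> enveloping_ideal p br \<or> v \<in> enveloping_ideal p br \<or> w \<in> enveloping_ideal p br" for u v w
    unfolding enveloping_kernel3_def using that by (intro cvec.span_base) blast
  have lin1: "linear_map (\<lambda>x. supercommutator3 p x y)" and lin2: "linear_map (supercommutator3 p x)"
      for x y
    unfolding supercommutator3_def by (rule extend2_linear)+
  have sc: "supercommutator3 p (extend f r) (extend h r)
      = quad_sum r (\<lambda>a b c d. supercommutator3 p (f (a, b)) (h (c, d)))" for f h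
    unfolding quad_sum_def case_prod_unfold prod.collapse
    by (subst linear_extend[OF lin1]) (subst linear_extend[OF lin2], rule refl)
  have il: "linear_map ?i" by (rule extend_linear)
  have "cybe_elem p r - ?i (yang_baxter p br r) = quad_sum r (\<lambda>a b c d.
      supercommutator3 p (basis ([a], [b], [])) (basis ([c], [], [d]))
    + supercommutator3 p (basis ([a], [b], [])) (basis ([], [c], [d]))
    + supercommutator3 p (basis ([a], [], [b])) (basis ([], [c], [d]))
    - ?i (scale (ksign (p a * p c)) (tensor (br (basis a) (basis c)) (tensor (basis b) (basis d)))
     + tensor (basis a) (tensor (br (basis b) (basis c)) (basis d))
     + scale (ksign (p a * p c)) (tensor (basis a) (tensor (basis c) (br (basis b) (basis d))))))"
    unfolding cybe_elem_def r12_def r13_def r23_def sc yang_baxter_def linear_quad_sum[OF il]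
    unfolding quad_sum_simps by simp
  also have "\<dots> \<in> cvec.span (enveloping_kernel3 p br)"
    using r
  proof (rule quad_sum_in_span)
    fix a b c d assume pp: "p b = p a" "p d = p c"
    have "supercommutator3 p (basis ([a], [b], [])) (basis ([c], [], [d]))
    + supercommutator3 p (basis ([a], [b], [])) (basis ([], [c], [d]))
    + supercommutator3 p (basis ([a], [], [b])) (basis ([], [c], [d]))
    - ?i (scale (ksign (p a * p c)) (tensor (br (basis a) (basis c)) (tensor (basis b) (basis d)))
     + tensor (basis a) (tensor (br (basis b) (basis c)) (basis d))
     + scale (ksign (p a * p c)) (tensor (basis a) (tensor (basis c) (br (basis b) (basis d)))))
     = scale (ksign (p a * p c)) (tensor (g a c) (tensor (basis [b]) (basis [d])))
     + tensor (basis [a]) (tensor (g b c) (basis [d]))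
     + scale (ksign (p a * p c)) (tensor (basis [a]) (tensor (basis [c]) (g b d)))"
      unfolding extend_simps i_tensor supercommutator3_def mult3_def extend2_basis g_def
      by (cases "p a"; cases "p c")
       (simp_all add: pp tensor_simps cvec.scale_right_distrib cvec.scale_right_diff_distrib
        parity3_def word_parity_def word_incl_def)
    also have "\<dots> \<in> cvec.span (enveloping_kernel3 p br)"
      by (intro cvec.span_add cvec.span_scale cvec.span_base ker) (simp_all add: g)
    finally show "supercommutator3 p (basis ([a], [b], [])) (basis ([c], [], [d]))
    + supercommutator3 p (basis ([a], [b], [])) (basis ([], [c], [d]))
    + supercommutator3 p (basis ([a], [], [b])) (basis ([], [c], [d]))
    - ?i (scale (ksign (p a * p c)) (tensor (br (basis a) (basis c)) (tensor (basis b) (basis d)))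
     + tensor (basis a) (tensor (br (basis b) (basis c)) (basis d))
     + scale (ksign (p a * p c)) (tensor (basis a) (tensor (basis c) (br (basis b) (basis d)))))
      \<in> cvec.span (enveloping_kernel3 p br)" .
  qed
  also have "\<dots> = enveloping_kernel3 p br"
    unfolding enveloping_kernel3_def by (rule cvec.span_span)
  finally show ?thesis .
qed

end

section \<open>The action of the superconformal algebra in coordinates\<close>

interpretation n2: lie_superalg n2_parity n2_bracket
  by (rule lie_superalg.intro) (rule n2_lie_superalgebra)

abbreviation n2_act :: "n2_basis \<Rightarrow> (n2_basis \<times> n2_basis) cvec \<Rightarrow> (n2_basis \<times> n2_basis) cvec" where
  "n2_act x \<equiv> diag_action n2_parity n2_bracket (basis x)"

fun n2_index :: "n2_basis \<Rightarrow> int" where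
  "n2_index (Lgen n) = n"
| "n2_index (Hgen n) = n"
| "n2_index (Ggen n) = n"
| "n2_index (Qgen n) = n"

text \<open>The eigenvalue of \<open>ad (L\<^sub>0 + \<i> H\<^sub>0)\<close>: minus the index, and the charge as imaginary part.\<close>

fun n2_degree :: "n2_basis \<Rightarrow> complex" where
  "n2_degree (Lgen n) = - of_int n"
| "n2_degree (Hgen n) = - of_int n"
| "n2_degree (Ggen n) = - of_int n + \<i>"
| "n2_degree (Qgen n) = - of_int n - \<i>"

text \<open>The transpose of \<open>ad x\<close>, acting on coordinate functions.\<close>

fun n2_coad :: "n2_basis \<Rightarrow> (n2_basis \<Rightarrow> complex) \<Rightarrow> n2_basis \<Rightarrow> complex" where
  "n2_coad (Lgen m) f (Lgen i) = of_int (2 * m - i) * f (Lgen (i - m))"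
| "n2_coad (Lgen m) f (Hgen i) = of_int (m - i) * f (Hgen (i - m))"
| "n2_coad (Lgen m) f (Ggen i) = of_int (2 * m - i) * f (Ggen (i - m))"
| "n2_coad (Lgen m) f (Qgen i) = of_int (m - i) * f (Qgen (i - m))"
| "n2_coad (Hgen m) f (Lgen i) = 0"
| "n2_coad (Hgen m) f (Hgen i) = of_int m * f (Lgen (i - m))"
| "n2_coad (Hgen m) f (Ggen i) = f (Ggen (i - m))"
| "n2_coad (Hgen m) f (Qgen i) = - f (Qgen (i - m))"
| "n2_coad (Ggen m) f (Lgen i) = 2 * f (Qgen (i - m))"
| "n2_coad (Ggen m) f (Hgen i) = 2 * of_int (m - i) * f (Qgen (i - m))"
| "n2_coad (Ggen m) f (Ggen i) = of_int (2 * m - i) * f (Lgen (i - m)) - f (Hgen (i - m))"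
| "n2_coad (Ggen m) f (Qgen i) = 0"
| "n2_coad (Qgen m) f (Lgen i) = 2 * f (Ggen (i - m))"
| "n2_coad (Qgen m) f (Hgen i) = - 2 * of_int m * f (Ggen (i - m))"
| "n2_coad (Qgen m) f (Ggen i) = 0"
| "n2_coad (Qgen m) f (Qgen i) = of_int m * f (Lgen (i - m)) + f (Hgen (i - m))"

lemma n2_coad_linear:
  "n2_coad x (\<lambda>a. f a + g a) b = n2_coad x f b + n2_coad x g b"
  "n2_coad x (\<lambda>a. c * f a) b = c * n2_coad x f b"
  "n2_coad x (\<lambda>a. 0) b = 0"
  by (cases x; cases b; simp add: algebra_simps)+

lemma lookup_n2_bracket:
  "Poly_Mapping.lookup (n2_bracket (basis x) u) a = n2_coad x (Poly_Mapping.lookup u) a"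
proof (rule cvec_induct[of _ u])
  fix b
  show "Poly_Mapping.lookup (n2_bracket (basis x) (basis b)) a = n2_coad x (Poly_Mapping.lookup
      (basis b)) a"
    by (cases x; cases b; cases a) (auto simp: lookup_basis lookup_minus)
next
  fix c u v
  assume "Poly_Mapping.lookup (n2_bracket (basis x) u) a = n2_coad x (Poly_Mapping.lookup u) a"
    "Poly_Mapping.lookup (n2_bracket (basis x) v) a = n2_coad x (Poly_Mapping.lookup v) a"
  moreover have "Poly_Mapping.lookup (scale c u + v) = (\<lambda>b. c * Poly_Mapping.lookup u b +
      Poly_Mapping.lookup v b)"
    by (auto simp: lookup_add)
  ultimately show "Poly_Mapping.lookup (n2_bracket (basis x) (scale c u + v)) a
      = n2_coad x (Poly_Mapping.lookup (scale c u + v)) a"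
    by (simp add: n2_bracket_linear lookup_add n2_coad_linear)
next
  have "Poly_Mapping.lookup 0 = (\<lambda>a::n2_basis. 0::complex)" by auto
  then show "Poly_Mapping.lookup (n2_bracket (basis x) 0) a = n2_coad x (Poly_Mapping.lookup 0) a"
    by (simp add: n2_bracket_linear n2_coad_linear)
qed

text \<open>Turns invariance and cocycle equations into scalar relations. In the second term the
  first slot is untouched, so its sign uses the parity of the target \<open>a\<close>.\<close>

lemma lookup_n2_act:
  "Poly_Mapping.lookup (n2_act x v) (a, b) = n2_coad x (\<lambda>c. Poly_Mapping.lookup v (c, b)) a
     + ksign (n2_parity x * n2_parity a) * n2_coad x (\<lambda>c. Poly_Mapping.lookup v (a, c)) b"
proof (rule cvec_induct[of _ v])
  fix t :: "n2_basis \<times> n2_basis"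
  obtain c d where t: "t = (c, d)" by (cases t)
  have 1: "(\<lambda>c'. Poly_Mapping.lookup (basis t) (c', b))
      = (\<lambda>c'. Poly_Mapping.lookup (basis d) b * Poly_Mapping.lookup (basis c) c')"
    "(\<lambda>d'. Poly_Mapping.lookup (basis t) (a, d'))
      = (\<lambda>d'. Poly_Mapping.lookup (basis c) a * Poly_Mapping.lookup (basis d) d')"
    by (auto simp: t lookup_basis)
  have "n2_act x (basis t) = n2_act x (tensor (basis c) (basis d))" by (simp add: t)
  also have "\<dots> = tensor (n2_bracket (basis x) (basis c)) (basis d)
      + scale (ksign (n2_parity x * n2_parity c)) (tensor (basis c) (n2_bracket (basis x) (basis d)))"
    by (rule n2.act_tensor[OF n2.basis_homogeneous n2.basis_homogeneous])
  finally show "Poly_Mapping.lookup (n2_act x (basis t)) (a, b)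
      = n2_coad x (\<lambda>c. Poly_Mapping.lookup (basis t) (c, b)) a
      + ksign (n2_parity x * n2_parity a) * n2_coad x (\<lambda>c. Poly_Mapping.lookup (basis t) (a, c)) b"
    unfolding 1 n2_coad_linear lookup_n2_bracket[symmetric]
    by (auto simp: lookup_add lookup_tensor lookup_basis)
qed (simp_all add: lookup_add n2_coad_linear diag_action_simps algebra_simps)

lemma lookup_n2_act3:
  "Poly_Mapping.lookup (diag_action3 n2_parity n2_bracket x v) (a, b, c)
     = n2_coad x (\<lambda>d. Poly_Mapping.lookup v (d, b, c)) a
     + ksign (n2_parity x * n2_parity a) * (n2_coad x (\<lambda>d. Poly_Mapping.lookup v (a, d, c)) b
     + ksign (n2_parity x * n2_parity b) * n2_coad x (\<lambda>d. Poly_Mapping.lookup v (a, b, d)) c)"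
proof (rule cvec_induct[of _ v])
  fix t :: "n2_basis \<times> n2_basis \<times> n2_basis"
  obtain a' t' where t: "t = (a', t')" by (cases t)
  have 1: "(\<lambda>d. Poly_Mapping.lookup (basis t) (d, b, c))
      = (\<lambda>d. Poly_Mapping.lookup (basis t') (b, c) * Poly_Mapping.lookup (basis a') d)"
    "(\<lambda>d. Poly_Mapping.lookup (basis t) (a, d, c))
      = (\<lambda>d. Poly_Mapping.lookup (basis a') a * Poly_Mapping.lookup (basis t') (d, c))"
    "(\<lambda>d. Poly_Mapping.lookup (basis t) (a, b, d))
      = (\<lambda>d. Poly_Mapping.lookup (basis a') a * Poly_Mapping.lookup (basis t') (b, d))"
    by (auto simp: t lookup_basis)
  have "diag_action3 n2_parity n2_bracket x (basis t)
      = diag_action3 n2_parity n2_bracket x (tensor (basis a') (basis t'))" by (simp add: t)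
  also have "\<dots> = tensor (n2_bracket (basis x) (basis a')) (basis t')
      + scale (ksign (n2_parity x * n2_parity a')) (tensor (basis a') (n2_act x (basis t')))"
    by (rule n2.diag_action3_tensor)
  finally show "Poly_Mapping.lookup (diag_action3 n2_parity n2_bracket x (basis t)) (a, b, c)
     = n2_coad x (\<lambda>d. Poly_Mapping.lookup (basis t) (d, b, c)) a
     + ksign (n2_parity x * n2_parity a) * (n2_coad x (\<lambda>d. Poly_Mapping.lookup (basis t) (a, d, c)) b
     + ksign (n2_parity x * n2_parity b) * n2_coad x (\<lambda>d. Poly_Mapping.lookup (basis t) (a, b, d)) c)"
    unfolding 1 n2_coad_linear lookup_n2_bracket[symmetric]
    by (auto simp: lookup_add lookup_tensor lookup_n2_act lookup_basis[of a'])
qed (simp_all add: lookup_add n2_coad_linear diag_action3_def extend_simps algebra_simps)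

section \<open>Elements killed by the odd generators\<close>

lemma finite_n2_index: "finite {a. \<bar>n2_index a\<bar> \<le> N}"
proof (rule finite_subset)
  show "{a. \<bar>n2_index a\<bar> \<le> N} \<subseteq> Lgen ` {-N..N} \<union> Hgen ` {-N..N} \<union> Ggen ` {-N..N} \<union> Qgen ` {-N..N}"
  proof
    fix a assume "a \<in> {a. \<bar>n2_index a\<bar> \<le> N}"
    then show "a \<in> Lgen ` {-N..N} \<union> Hgen ` {-N..N} \<union> Ggen ` {-N..N} \<union> Qgen ` {-N..N}"
      by (cases a) (simp_all add: image_iff abs_le_iff)
  qed
qed simp

lemma bounded_support:
  fixes v :: "'a cvec" and f :: "'a \<Rightarrow> int"
  shows "\<exists>N. \<forall>a. Poly_Mapping.lookup v a \<noteq> 0 \<longrightarrow> \<bar>f a\<bar> \<le> N"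
  \<comment> \<open>For \<open>v = 0\<close> this is the maximum of the empty set, but then the
    bound is vacuous.\<close>
  by (intro exI[of _ "Max ((\<lambda>a. \<bar>f a\<bar>) ` Poly_Mapping.keys v)"]) (auto simp: in_keys_iff)

text \<open>For fixed \<open>i\<close> and large \<open>m\<close> the target index
  \<open>i + m\<close> exceeds \<open>N\<close>. The Q coordinate gives
  \<open>m f(L_i) + f(H_i) = 0\<close> for two consecutive \<open>m\<close>, which kills both
  values; the L coordinate gives \<open>2 f(G_i) = 0\<close>.\<close>

lemma n2_coad_Q_kernel:
  assumes "\<And>m a. n2_index a > N \<Longrightarrow> n2_coad (Qgen m) f a = 0"
    and "\<And>i. a \<noteq> Qgen i"
  shows "f a = 0"
proof -
  have Q: "of_int m * f (Lgen i) + f (Hgen i) = 0" if "m > N - i" for m i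
    using assms(1)[of "Qgen (i + m)" m] that by simp
  \<comment> \<open>The least \<open>m\<close> for which \<open>i + m\<close> exceeds
    \<open>N\<close>.\<close>
  define m where "m i = N - i + 1" for i
  have L: "f (Lgen i) = 0" for i
  proof -
    have "(of_int (m i + 1) * f (Lgen i) + f (Hgen i)) - (of_int (m i) * f (Lgen i) + f (Hgen i)) = 0"
      using Q[where i = i and m = "m i"] Q[where i = i and m = "m i + 1"] by (simp add: m_def)
    then show ?thesis by (simp add: algebra_simps)
  qed
  have H: "f (Hgen i) = 0" for i
    using Q[where i = i and m = "m i"] L by (simp add: m_def)
  have G: "f (Ggen i) = 0" for i
    using assms(1)[of "Lgen (i + m i)" "m i"] by (simp add: m_def)
  show ?thesis using L H G assms(2) by (cases a) auto
qed

text \<open>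
  For large \<open>m\<close> the images of \<open>v\<close> under \<open>Q\<^sub>m\<close> acting on the various tensor factors have disjoint
  supports, so that \<open>v\<close> is killed factor by factor.
\<close>

lemma n2_act_Q_kernel:
  assumes "\<And>m. n2_act (Qgen m) v = 0" and "(\<forall>i. a \<noteq> Qgen i) \<or> (\<forall>i. b \<noteq> Qgen i)"
  shows "Poly_Mapping.lookup v (a, b) = 0"
proof -
  obtain N1 where N1: "Poly_Mapping.lookup v t \<noteq> 0 \<Longrightarrow> \<bar>n2_index (fst t)\<bar> \<le> N1" for t
    using bounded_support[of v "\<lambda>t. n2_index (fst t)"] by blast
  obtain N2 where N2: "Poly_Mapping.lookup v t \<noteq> 0 \<Longrightarrow> \<bar>n2_index (snd t)\<bar> \<le> N2" for t
    using bounded_support[of v "\<lambda>t. n2_index (snd t)"] by blast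
  have eq: "n2_coad (Qgen m) (\<lambda>c. Poly_Mapping.lookup v (c, b)) a
     + ksign (n2_parity a) * n2_coad (Qgen m) (\<lambda>c. Poly_Mapping.lookup v (a, c)) b = 0" for m a b
    using lookup_n2_act[of "Qgen m" v a b] by (simp only: assms(1) n2_parity.simps mult_1 lookup_zero)
  from assms(2) show ?thesis
  proof
    assume a: "\<forall>i. a \<noteq> Qgen i"
    show ?thesis
    proof (rule n2_coad_Q_kernel[where N = N1 and f = "\<lambda>a. Poly_Mapping.lookup v (a, b)"])
      fix m and c assume "n2_index c > N1"
      then have 0: "(\<lambda>d. Poly_Mapping.lookup v (c, d)) = (\<lambda>d. 0)"
        using N1 by fastforce
      show "n2_coad (Qgen m) (\<lambda>a. Poly_Mapping.lookup v (a, b)) c = 0"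
        using eq[of m b c] by (simp add: 0 n2_coad_linear)
    qed (use a in auto)
  next
    assume b: "\<forall>i. b \<noteq> Qgen i"
    show ?thesis
    proof (rule n2_coad_Q_kernel[where N = N2 and f = "\<lambda>b. Poly_Mapping.lookup v (a, b)"])
      fix m and c assume "n2_index c > N2"
      then have 0: "(\<lambda>d. Poly_Mapping.lookup v (d, c)) = (\<lambda>d. 0)"
        using N2 by fastforce
      show "n2_coad (Qgen m) (\<lambda>b. Poly_Mapping.lookup v (a, b)) c = 0"
        using eq[of m c a] by (cases "n2_parity a") (simp_all add: 0 n2_coad_linear)
    qed (use b in auto)
  qed
qed

lemma n2_act3_Q_kernel:
  assumes "\<And>m. diag_action3 n2_parity n2_bracket (Qgen m) v = 0"
    and "(\<forall>i. a \<noteq> Qgen i) \<or> (\<forall>i. b \<noteq> Qgen i) \<or> (\<forall>i. c \<noteq> Qgen i)"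
  shows "Poly_Mapping.lookup v (a, b, c) = 0"
proof -
  obtain N1 where N1: "Poly_Mapping.lookup v t \<noteq> 0 \<Longrightarrow> \<bar>n2_index (fst t)\<bar> \<le> N1" for t
    using bounded_support[of v "\<lambda>t. n2_index (fst t)"] by blast
  obtain N2 where N2: "Poly_Mapping.lookup v t \<noteq> 0 \<Longrightarrow> \<bar>n2_index (fst (snd t))\<bar> \<le> N2" for t
    using bounded_support[of v "\<lambda>t. n2_index (fst (snd t))"] by blast
  obtain N3 where N3: "Poly_Mapping.lookup v t \<noteq> 0 \<Longrightarrow> \<bar>n2_index (snd (snd t))\<bar> \<le> N3" for t
    using bounded_support[of v "\<lambda>t. n2_index (snd (snd t))"] by blast
  have eq: "n2_coad (Qgen m) (\<lambda>d. Poly_Mapping.lookup v (d, b, c)) a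
     + ksign (n2_parity a) * (n2_coad (Qgen m) (\<lambda>d. Poly_Mapping.lookup v (a, d, c)) b
     + ksign (n2_parity b) * n2_coad (Qgen m) (\<lambda>d. Poly_Mapping.lookup v (a, b, d)) c) = 0" for m a b c
    using lookup_n2_act3[of "Qgen m" v a b c] by (simp only: assms(1) n2_parity.simps mult_1 lookup_zero)
  from assms(2) consider "\<forall>i. a \<noteq> Qgen i" | "\<forall>i. b \<noteq> Qgen i" | "\<forall>i. c \<noteq> Qgen i" by blast
  then show ?thesis
  proof cases
    case 1
    show ?thesis
    proof (rule n2_coad_Q_kernel[where N = N1 and f = "\<lambda>a. Poly_Mapping.lookup v (a, b, c)"])
      fix m x assume "n2_index x > N1"
      then have 0: "Poly_Mapping.lookup v (x, t) = 0" for t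
        using N1[of "(x, t)"] by force
      show "n2_coad (Qgen m) (\<lambda>a. Poly_Mapping.lookup v (a, b, c)) x = 0"
        using eq[of m b c x] by (simp add: 0 n2_coad_linear)
    qed (use 1 in auto)
  next
    case 2
    show ?thesis
    proof (rule n2_coad_Q_kernel[where N = N2 and f = "\<lambda>b. Poly_Mapping.lookup v (a, b, c)"])
      fix m x assume "n2_index x > N2"
      then have 0: "Poly_Mapping.lookup v (s, x, t) = 0" for s t
        using N2[of "(s, x, t)"] by force
      show "n2_coad (Qgen m) (\<lambda>b. Poly_Mapping.lookup v (a, b, c)) x = 0"
        using eq[of m x c a] by (cases "n2_parity a") (simp_all add: 0 n2_coad_linear)
    qed (use 2 in auto)
  next
    case 3
    show ?thesis
    proof (rule n2_coad_Q_kernel[where N = N3 and f = "\<lambda>c. Poly_Mapping.lookup v (a, b, c)"])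
      fix m x assume "n2_index x > N3"
      then have 0: "Poly_Mapping.lookup v (s, t, x) = 0" for s t
        using N3[of "(s, t, x)"] by force
      show "n2_coad (Qgen m) (\<lambda>c. Poly_Mapping.lookup v (a, b, c)) x = 0"
        using eq[of m b x a] by (cases "n2_parity a"; cases "n2_parity b") (simp_all add: 0
            n2_coad_linear)
    qed (use 3 in auto)
  qed
qed

text \<open>Being killed by all \<open>Q_m\<close> leaves only the coordinates at
  \<open>Q \<otimes> Q\<close>, and \<open>H_0\<close> multiplies these by -2.\<close>

lemma n2_act_invariant:
  assumes "\<And>x. n2_act x v = 0"
  shows "v = 0"
proof (rule poly_mapping_eqI)
  fix t :: "n2_basis \<times> n2_basis"
  obtain a b where t: "t = (a, b)" by (cases t)
  show "Poly_Mapping.lookup v t = Poly_Mapping.lookup 0 t"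
  proof (cases "(\<forall>i. a \<noteq> Qgen i) \<or> (\<forall>i. b \<noteq> Qgen i)")
    case True
    then show ?thesis using n2_act_Q_kernel assms t by simp
  next
    case False
    then obtain i j where "a = Qgen i" "b = Qgen j" by blast
    then show ?thesis
      using lookup_n2_act[of "Hgen 0" v a b] assms[of "Hgen 0"] t by simp
  qed
qed

text \<open>As for two factors, with eigenvalue -3 of \<open>H_0\<close> on
  \<open>Q \<otimes> Q \<otimes> Q\<close>.\<close>

lemma n2_act3_invariant:
  assumes "\<And>x. diag_action3 n2_parity n2_bracket x v = 0"
  shows "v = 0"
proof (rule poly_mapping_eqI)
  fix t :: "n2_basis \<times> n2_basis \<times> n2_basis"
  obtain a b c where t: "t = (a, b, c)" by (cases t)
  show "Poly_Mapping.lookup v t = Poly_Mapping.lookup 0 t"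
  proof (cases "(\<forall>i. a \<noteq> Qgen i) \<or> (\<forall>i. b \<noteq> Qgen i) \<or> (\<forall>i. c \<noteq> Qgen i)")
    case True
    then show ?thesis using n2_act3_Q_kernel assms t by simp
  next
    case False
    then obtain i j k where "a = Qgen i" "b = Qgen j" "c = Qgen k" by blast
    then show ?thesis
      using lookup_n2_act3[of "Hgen 0" v a b c] assms[of "Hgen 0"] t by simp
  qed
qed

section \<open>Graded cocycles\<close>

abbreviation coord :: "('a \<times> 'b) cvec \<Rightarrow> 'a \<Rightarrow> 'b \<Rightarrow> complex" where
  "coord v a b \<equiv> Poly_Mapping.lookup v (a, b)"

lemma coord_eqI: "(\<And>a b. coord v a b = coord w a b) \<Longrightarrow> v = w"
  by (rule poly_mapping_eqI) (metis prod.collapse)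

text \<open>The eigenspace of \<open>L_0 + \<i> H_0\<close> for the eigenvalue
  \<open>d\<close>.\<close>

definition n2_graded :: "complex \<Rightarrow> (n2_basis \<times> n2_basis) cvec \<Rightarrow> bool" where
  "n2_graded d v \<longleftrightarrow> (\<forall>a b. n2_degree a + n2_degree b \<noteq> d \<longrightarrow> coord v a b = 0)"

text \<open>The signs are those of the 1-cocycle identity for an even map.\<close>

definition n2_cocycle :: "(n2_basis cvec \<Rightarrow> (n2_basis \<times> n2_basis) cvec) \<Rightarrow> bool" where
  "n2_cocycle D \<longleftrightarrow> linear_map D \<and> (\<forall>x y. D (n2_basis_bracket x y)
     = n2_act x (D (basis y)) - scale (ksign (n2_parity x * n2_parity y)) (n2_act y (D (basis x))))"

definition n2_graded_cocycle :: "(n2_basis cvec \<Rightarrow> (n2_basis \<times> n2_basis) cvec) \<Rightarrow> bool" where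
  "n2_graded_cocycle D \<longleftrightarrow> n2_cocycle D \<and> (\<forall>x. n2_graded (n2_degree x) (D (basis x)))"

lemma n2_coad_degree:
  assumes "\<And>c. n2_degree a = n2_degree x + n2_degree c \<Longrightarrow> f c = 0"
  shows "n2_coad x f a = 0"
  using assms by (cases x; cases a) (simp_all add: complex_eq_iff)

lemma n2_graded_act: "n2_graded d v \<Longrightarrow> n2_graded (n2_degree x + d) (n2_act x v)"
  unfolding n2_graded_def
proof (intro allI impI)
  fix a b
  assume v: "\<forall>a b. n2_degree a + n2_degree b \<noteq> d \<longrightarrow> coord v a b = 0"
    and ab: "n2_degree a + n2_degree b \<noteq> n2_degree x + d"
  have "n2_coad x (\<lambda>c. coord v c b) a = 0" "n2_coad x (\<lambda>c. coord v a c) b = 0"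
    by (rule n2_coad_degree, use v ab in \<open>auto simp: algebra_simps\<close>)+
  then show "coord (n2_act x v) a b = 0" by (simp add: lookup_n2_act)
qed

lemma n2_graded_diff: "n2_graded d v \<Longrightarrow> n2_graded d w \<Longrightarrow> n2_graded d (v - w)"
  by (simp add: n2_graded_def lookup_minus)

text \<open>The charges of the two entries are opposite, and parity is charge modulo 2.\<close>

lemma n2_graded_0_even:
  assumes "n2_graded 0 r"
  shows "r \<in> homogeneous (parity2 n2_parity) 0"
  unfolding homogeneous_iff
proof (intro allI impI)
  fix t assume t: "Poly_Mapping.lookup r t \<noteq> 0"
  obtain a b where ab: "t = (a, b)" by (cases t)
  have "n2_degree a + n2_degree b = 0" using assms t unfolding ab n2_graded_def by blast
  then show "parity2 n2_parity t = 0"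
    unfolding ab by (cases a; cases b) (simp_all add: parity2_def complex_eq_iff)
qed

lemma n2_cocycle_diff:
  assumes "n2_cocycle D"
  shows "n2_cocycle (\<lambda>x. D x - diag_action n2_parity n2_bracket x r)"
proof -
  have "n2_act x (D (basis y)) - scale s (n2_act y (D (basis x)))
        - (n2_act x (n2_act y r) - scale s (n2_act y (n2_act x r)))
      = n2_act x (D (basis y) - n2_act y r) - scale s (n2_act y (D (basis x) - n2_act x r))" for x y s
    by (simp add: diag_action_simps cvec.scale_right_diff_distrib)
  moreover have "diag_action n2_parity n2_bracket (n2_basis_bracket x y) r
      = n2_act x (n2_act y r) - scale (ksign (n2_parity x * n2_parity y)) (n2_act y (n2_act x r))"
          for x y
    using n2.act_br[OF n2.basis_homogeneous n2.basis_homogeneous, of x y r] by simp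
  ultimately show ?thesis
    using assms unfolding n2_cocycle_def linear_map_iff
    by (simp add: diag_action_simps cvec.scale_right_diff_distrib)
qed

lemma n2_graded_cocycle_diff:
  assumes "n2_graded_cocycle D" "n2_graded 0 r"
  shows "n2_graded_cocycle (\<lambda>x. D x - diag_action n2_parity n2_bracket x r)"
  using assms n2_cocycle_diff n2_graded_diff n2_graded_act[OF assms(2)]
  unfolding n2_graded_cocycle_def by simp

lemma n2_cocycleD:
  assumes "n2_cocycle D"
  shows "D (n2_basis_bracket x y)
     = n2_act x (D (basis y)) - scale (ksign (n2_parity x * n2_parity y)) (n2_act y (D (basis x)))"
    and "D (u + v) = D u + D v" "D (scale c u) = scale c (D u)" "D 0 = 0" "D (- u) = - D u"
proof -
  interpret Vector_Spaces.linear scale scale D using assms unfolding n2_cocycle_def by blast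
  show "D (u + v) = D u + D v" "D (scale c u) = scale c (D u)" "D 0 = 0" "D (- u) = - D u"
    by (rule add scale zero neg)+
qed (use assms in \<open>auto simp: n2_cocycle_def\<close>)

text \<open>
  The Cartan element \<open>h = L\<^sub>0 + \<i> H\<^sub>0\<close> acts diagonally and its eigenvalues record weight and charge.
  Dividing \<open>D h\<close> by the nonzero eigenvalues makes it an \<open>h\<close>-invariant, and then \<open>D\<close> is graded.
\<close>

lemma n2_cocycle_make_graded:
  assumes D: "n2_cocycle D" and even: "\<And>x. n2_parity x = 0 \<Longrightarrow> D (basis x) \<in> homogeneous (parity2
      n2_parity) 0"
  obtains r where "r \<in> homogeneous (parity2 n2_parity) 0"
    and "n2_graded_cocycle (\<lambda>x. D x - diag_action n2_parity n2_bracket x r)"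
proof -
  define \<delta> where "\<delta> = (\<lambda>(a, b). n2_degree a + n2_degree b)"
  define act_h where "act_h v = n2_act (Lgen 0) v + scale \<i> (n2_act (Hgen 0) v)" for v
  have coad_h: "n2_coad (Lgen 0) f a + \<i> * n2_coad (Hgen 0) f a = n2_degree a * f a" for f a
    by (cases a) (simp_all add: algebra_simps)
  have act_h: "Poly_Mapping.lookup (act_h v) t = \<delta> t * Poly_Mapping.lookup v t" for v t
  proof -
    obtain a b where t: "t = (a, b)" by (cases t)
    have "Poly_Mapping.lookup (act_h v) t
        = (n2_coad (Lgen 0) (\<lambda>c. coord v c b) a + \<i> * n2_coad (Hgen 0) (\<lambda>c. coord v c b) a)
        + (n2_coad (Lgen 0) (\<lambda>c. coord v a c) b + \<i> * n2_coad (Hgen 0) (\<lambda>c. coord v a c) b)"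
      by (simp add: act_h_def t lookup_add lookup_n2_act algebra_simps del: n2_coad.simps)
    then show ?thesis unfolding coad_h by (simp add: t \<delta>_def algebra_simps)
  qed
  have bracket_h: "n2_basis_bracket (Lgen 0) x + scale \<i> (n2_basis_bracket (Hgen 0) x)
      = scale (n2_degree x) (basis x)" for x
    by (cases x) (auto intro!: poly_mapping_eqI simp: lookup_add lookup_minus lookup_basis algebra_simps)
  define w where "w = D (basis (Lgen 0)) + scale \<i> (D (basis (Hgen 0)))"
  \<comment> \<open>Division by zero yields 0, so exactly the degree-zero part of \<open>w\<close>
    is left uncorrected and survives in \<open>w'\<close>.\<close>
  define r where "r = extend (\<lambda>t. scale (1 / \<delta> t) (basis t)) w"
  have r: "Poly_Mapping.lookup r t = Poly_Mapping.lookup w t / \<delta> t" for t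
    by (simp add: r_def lookup_extend_diagonal)
  have "w \<in> homogeneous (parity2 n2_parity) 0"
    unfolding w_def by (intro homogeneous_closed even) simp_all
  then have r_even: "r \<in> homogeneous (parity2 n2_parity) 0"
    unfolding homogeneous_iff r by auto
  define D' where "D' = (\<lambda>x. D x - diag_action n2_parity n2_bracket x r)"
  have D': "n2_cocycle D'" unfolding D'_def using D by (rule n2_cocycle_diff)
  define w' where "w' = D' (basis (Lgen 0)) + scale \<i> (D' (basis (Hgen 0)))"
  have "w' = w - act_h r"
    by (simp add: w'_def D'_def w_def act_h_def cvec.scale_right_diff_distrib)
  then have w': "n2_graded 0 w'"
    unfolding n2_graded_def by (auto simp: lookup_minus act_h r \<delta>_def)
  have "n2_graded (n2_degree x) (D' (basis x))" for x
    unfolding n2_graded_def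
  proof (intro allI impI)
    fix a b assume ab: "n2_degree a + n2_degree b \<noteq> n2_degree x"
    \<comment> \<open>The cocycle identity for \<open>[h, x] = deg(x) x\<close>. At a coordinate of
      another degree \<open>x \<cdot> w'\<close> vanishes, and the two eigenvalues differ.\<close>
    have "scale (n2_degree x) (D' (basis x))
        = D' (n2_basis_bracket (Lgen 0) x + scale \<i> (n2_basis_bracket (Hgen 0) x))"
      unfolding bracket_h by (simp only: n2_cocycleD[OF D'])
    also have "\<dots> = act_h (D' (basis x)) - n2_act x w'"
      unfolding n2_cocycleD[OF D'] w'_def act_h_def
      by (simp add: diag_action_simps cvec.scale_right_diff_distrib)
    finally have "n2_degree x * coord (D' (basis x)) a b
        = (n2_degree a + n2_degree b) * coord (D' (basis x)) a b - coord (n2_act x w') a b"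
      by (metis lookup_scale lookup_minus act_h \<delta>_def case_prod_conv)
    moreover have "coord (n2_act x w') a b = 0"
      using n2_graded_act[OF w', of x] ab unfolding n2_graded_def by simp
    ultimately show "coord (D' (basis x)) a b = 0" using ab by auto
  qed
  with D' have "n2_graded_cocycle D'" by (simp add: n2_graded_cocycle_def)
  with r_even show thesis unfolding D'_def by (rule that)
qed

text \<open>A bounded range of indices contains finitely many generators, so the function is
  finitely supported. It supplies the witnesses \<open>r\<close> below.\<close>

lemma n2_exists_coord:
  assumes "\<And>a b. f a b \<noteq> 0 \<Longrightarrow> \<bar>n2_index a\<bar> \<le> N \<and> \<bar>n2_index b\<bar> \<le> N"
  obtains r where "\<And>a b. coord r a b = f a b"
proof -
  have "{t. (\<lambda>(a, b). f a b) t \<noteq> 0} \<subseteq> {a. \<bar>n2_index a\<bar> \<le> N} \<times> {a. \<bar>n2_index a\<bar> \<le> N}"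
    using assms by auto
  then have "finite {t. (\<lambda>(a, b). f a b) t \<noteq> 0}"
    by (rule finite_subset) (intro finite_cartesian_product finite_n2_index)
  then have "coord (Abs_poly_mapping (\<lambda>(a, b). f a b)) a b = f a b" for a b
    by (simp add: Abs_poly_mapping_inverse)
  then show thesis by (rule that)
qed

lemma n2_coord_bounded:
  fixes v :: "(n2_basis \<times> n2_basis) cvec"
  obtains N where "\<And>a b. coord v a b \<noteq> 0 \<Longrightarrow> \<bar>n2_index a\<bar> \<le> N \<and> \<bar>n2_index b\<bar> \<le> N"
proof -
  obtain N1 where N1: "Poly_Mapping.lookup v t \<noteq> 0 \<Longrightarrow> \<bar>n2_index (fst t)\<bar> \<le> N1" for t
    using bounded_support[of v "\<lambda>t. n2_index (fst t)"] by blast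
  obtain N2 where N2: "Poly_Mapping.lookup v t \<noteq> 0 \<Longrightarrow> \<bar>n2_index (snd t)\<bar> \<le> N2" for t
    using bounded_support[of v "\<lambda>t. n2_index (snd t)"] by blast
  show thesis
  proof (rule that[of "max N1 N2"])
    fix a b assume "coord v a b \<noteq> 0"
    then show "\<bar>n2_index a\<bar> \<le> max N1 N2 \<and> \<bar>n2_index b\<bar> \<le> max N1 N2"
      using N1[of "(a, b)"] N2[of "(a, b)"] by auto
  qed
qed

section \<open>Making a graded cocycle vanish on the generators Q\<close>

text \<open>\<open>[Q_m, Q_n] = 0\<close>, and oddness of both turns the difference in the cocycle
  identity into a sum.\<close>

lemma n2_cocycle_QQ:
  assumes "n2_cocycle D"
  shows "n2_act (Qgen m) (D (basis (Qgen n))) + n2_act (Qgen n) (D (basis (Qgen m))) = 0"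
  using n2_cocycleD(1)[OF assms, of "Qgen m" "Qgen n"] n2_cocycleD(4)[OF assms] by simp

lemma n2_act_Q_square:
  assumes "n2_cocycle D"
  shows "n2_act (Qgen m) (D (basis (Qgen m))) = 0"
proof -
  have "scale 2 (n2_act (Qgen m) (D (basis (Qgen m)))) = 0"
    using n2_cocycle_QQ[OF assms, of m m] by (simp add: poly_mapping_eq_iff fun_eq_iff lookup_add)
  then show ?thesis by (simp add: poly_mapping_eq_iff fun_eq_iff)
qed

section \<open>Normalising a graded cocycle on the generators Q\<close>

text \<open>
  The operator \<open>ad Q\<^sub>0\<close> has square zero and is acyclic.
\<close>

lemma n2_kill_Q0:
  assumes D: "n2_graded_cocycle D"
  obtains r where "n2_graded 0 r" "n2_act (Qgen 0) r = D (basis (Qgen 0))"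
proof -
  define F where "F = D (basis (Qgen 0))"
  have g: "coord F a b = 0" if "n2_degree a + n2_degree b \<noteq> - \<i>" for a b
    using D that unfolding n2_graded_cocycle_def n2_graded_def F_def by (metis add.left_neutral
        diff_0 minus_zero n2_degree.simps(4) of_int_0)
  have "n2_act (Qgen 0) F = 0"
    using D n2_act_Q_square unfolding F_def n2_graded_cocycle_def by blast
  then have "coord (n2_act (Qgen 0) F) (Qgen i) (Qgen j) = 0" for i j by simp
  then have sym: "coord F (Hgen i) (Qgen j) = coord F (Qgen i) (Hgen j)" for i j
    by (simp add: lookup_n2_act)
  obtain N where N: "coord F a b \<noteq> 0 \<Longrightarrow> \<bar>n2_index a\<bar> \<le> N \<and> \<bar>n2_index b\<bar> \<le> N" for a b
    using n2_coord_bounded[of F] by blast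
  \<comment> \<open>\<open>ad Q_0\<close> maps \<open>H_j\<close> to \<open>Q_j\<close> up to sign,
    so \<open>r\<close> is \<open>F\<close> with Q replaced by H. The \<open>H \<otimes> H\<close>
    coordinate serves both \<open>Q \<otimes> H\<close> and \<open>H \<otimes> Q\<close>,
    consistently by \<open>sym\<close>.\<close>
  define f where "f a b = (case (a, b) of (Lgen i, Hgen j) \<Rightarrow> coord F (Lgen i) (Qgen j)
      | (Hgen i, Lgen j) \<Rightarrow> coord F (Qgen i) (Lgen j)
      | (Hgen i, Hgen j) \<Rightarrow> coord F (Qgen i) (Hgen j) | _ \<Rightarrow> 0)" for a b
  have "\<bar>n2_index a\<bar> \<le> N \<and> \<bar>n2_index b\<bar> \<le> N" if "f a b \<noteq> 0" for a b
    using that N by (cases a; cases b) (fastforce simp: f_def)+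
  then obtain r where r: "coord r a b = f a b" for a b
    using n2_exists_coord[of f N] by blast
  have "n2_graded 0 r"
    unfolding n2_graded_def r
  proof (intro allI impI)
    fix a b assume "n2_degree a + n2_degree b \<noteq> 0"
    then show "f a b = 0" by (cases a; cases b) (simp_all add: f_def g complex_eq_iff)
  qed
  moreover have "n2_act (Qgen 0) r = F"
  proof (rule coord_eqI)
    fix a b
    show "coord (n2_act (Qgen 0) r) a b = coord F a b"
      by (cases a; cases b) (simp_all add: lookup_n2_act r f_def g sym complex_eq_iff)
  qed
  ultimately show thesis unfolding F_def by (rule that)
qed

text \<open>The relations \<open>[Q_0, Q_1] = [Q_1, Q_1] = 0\<close> express the
  \<open>Q \<otimes> H\<close> and \<open>Q \<otimes> L\<close> coordinates of \<open>D Q_1\<close>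
  by the other two families, and those can be matched explicitly.\<close>

lemma n2_kill_Q1:
  assumes D: "n2_graded_cocycle D" "D (basis (Qgen 0)) = 0"
  obtains r where "n2_graded 0 r" "n2_act (Qgen 0) r = 0" "n2_act (Qgen 1) r = D (basis (Qgen 1))"
proof -
  have cocycle: "n2_cocycle D" using D by (simp add: n2_graded_cocycle_def)
  define F where "F = D (basis (Qgen 1))"
  have g: "coord F a b = 0" if "n2_degree a + n2_degree b \<noteq> - 1 - \<i>" for a b
    using D that unfolding n2_graded_cocycle_def n2_graded_def F_def by (metis n2_degree.simps(4)
        of_int_1)
  have "n2_act (Qgen 0) F = 0"
    using n2_cocycle_QQ[OF cocycle, of 0 1] D(2) unfolding F_def by (simp add: diag_action_simps)
  then have "coord (n2_act (Qgen 0) F) (Qgen i) (Qgen j) = 0" for i j by simp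
  then have sym: "coord F (Qgen i) (Hgen j) = coord F (Hgen i) (Qgen j)" for i j
    by (simp add: lookup_n2_act)
  have "n2_act (Qgen 1) F = 0" unfolding F_def using cocycle by (rule n2_act_Q_square)
  then have QQ: "coord (n2_act (Qgen 1) F) (Qgen i) (Qgen (j + 1)) = 0" for i j by simp
  have QL: "coord F (Qgen i) (Lgen j) = coord F (Lgen (i - 1)) (Qgen (j + 1))
      + coord F (Hgen (i - 1)) (Qgen (j + 1)) - coord F (Hgen i) (Qgen j)" for i j
    using QQ[of i j] by (simp add: lookup_n2_act sym algebra_simps)
  obtain N where N: "coord F a b \<noteq> 0 \<Longrightarrow> \<bar>n2_index a\<bar> \<le> N \<and> \<bar>n2_index b\<bar> \<le> N" for a b
    using n2_coord_bounded[of F] by blast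
  \<comment> \<open>The \<open>H \<otimes> Q\<close> coordinates of \<open>F\<close> fix
    \<open>G \<otimes> Q\<close>; then \<open>Q_0 \<cdot> r = 0\<close> forces
    \<open>L \<otimes> H\<close>, and the \<open>L \<otimes> Q\<close> coordinates fix
    \<open>L \<otimes> L\<close>. The shifts by one undo that of \<open>Q_1\<close>.\<close>
  define f where "f a b = (case (a, b) of
        (Lgen i, Lgen j) \<Rightarrow> coord F (Lgen i) (Qgen (j + 1)) + coord F (Hgen i) (Qgen (j + 1))
           - coord F (Hgen (i + 1)) (Qgen j)
      | (Lgen i, Hgen j) \<Rightarrow> coord F (Hgen (i + 1)) (Qgen j)
      | (Ggen i, Qgen j) \<Rightarrow> - coord F (Hgen (i + 1)) (Qgen j) / 2 | _ \<Rightarrow> 0)" for a b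
  have "\<bar>n2_index a\<bar> \<le> N + 1 \<and> \<bar>n2_index b\<bar> \<le> N + 1" if "f a b \<noteq> 0" for a b
  proof (rule ccontr)
    assume "\<not> (\<bar>n2_index a\<bar> \<le> N + 1 \<and> \<bar>n2_index b\<bar> \<le> N + 1)"
    then have out: "n2_index a < - N - 1 \<or> N + 1 < n2_index a \<or> n2_index b < - N - 1 \<or> N + 1 <
        n2_index b"
      by linarith
    have F0: "coord F c d = 0" if "n2_index c < - N \<or> N < n2_index c \<or> n2_index d < - N \<or> N <
        n2_index d" for c d
      using N[of c d] that by linarith
    have "f a b = 0"
      using out by (cases a; cases b) (auto simp: f_def F0)
    with that show False ..
  qed
  then obtain r where r: "coord r a b = f a b" for a b
    using n2_exists_coord[of f "N + 1"] by blast
  have "n2_graded 0 r"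
    unfolding n2_graded_def r
  proof (intro allI impI)
    fix a b assume "n2_degree a + n2_degree b \<noteq> 0"
    then show "f a b = 0" by (cases a; cases b) (simp_all add: f_def g complex_eq_iff)
  qed
  moreover have "n2_act (Qgen 0) r = 0"
  proof (rule coord_eqI)
    fix a b
    show "coord (n2_act (Qgen 0) r) a b = coord 0 a b"
      by (cases a; cases b) (simp_all add: lookup_n2_act r f_def)
  qed
  moreover have "n2_act (Qgen 1) r = F"
  proof (rule coord_eqI)
    fix a b
    show "coord (n2_act (Qgen 1) r) a b = coord F a b"
      by (cases a; cases b) (simp_all add: lookup_n2_act r f_def g sym QL complex_eq_iff)
  qed
  ultimately show thesis unfolding F_def by (rule that)
qed

text \<open>
  At this stage the remaining freedom is \<open>r = R(c)\<close>, with coordinates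
  \<open>2 (y - x) c\<close>, \<open>- 2 y c\<close>, \<open>2 x c\<close>, \<open>y c\<close>, \<open>x c\<close> at \<open>L \<otimes> L\<close>, \<open>L \<otimes> H\<close>, \<open>H \<otimes> L\<close>, \<open>G \<otimes> Q\<close>, \<open>Q \<otimes> G\<close>
  for a Laurent polynomial \<open>c(x, y)\<close> of degree -1, and \<open>Q\<^sub>2 \<cdot> R(c)\<close> has \<open>Q \<otimes> H\<close> coordinate
  \<open>- 4 x y (x - y) c\<close>. That the coordinate \<open>g\<close> of \<open>D Q\<^sub>2\<close> is divisible by \<open>x - y\<close>, that is, a
  difference, follows from the cocycle identity for \<open>[Q\<^sub>2, L\<^sub>-\<^sub>1] = 2 Q\<^sub>1\<close>.
\<close>

lemma n2_kill_Q2: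
  assumes D: "n2_graded_cocycle D" "D (basis (Qgen 0)) = 0" "D (basis (Qgen 1)) = 0"
  obtains r where "n2_graded 0 r" "n2_act (Qgen 0) r = 0" "n2_act (Qgen 1) r = 0"
    "\<And>i j. coord (n2_act (Qgen 2) r) (Qgen i) (Hgen j) = coord (D (basis (Qgen 2))) (Qgen i) (Hgen j)"
proof -
  have cocycle: "n2_cocycle D" using D by (simp add: n2_graded_cocycle_def)
  define F where "F = D (basis (Qgen 2))"
  define E where "E = D (basis (Lgen (- 1)))"
  \<comment> \<open>\<open>[Q_m, L_{-1}] = m Q_{m-1}\<close>, on which \<open>D\<close> vanishes for
    \<open>m = 0, 1, 2\<close>.\<close>
  have act0: "n2_act (Qgen 0) E = 0"
    using n2_cocycleD(1)[OF cocycle, of "Qgen 0" "Lgen (-1)"] D(2)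
    by (simp add: E_def diag_action_simps n2_cocycleD[OF cocycle])
  have act1: "n2_act (Qgen 1) E = 0"
    using n2_cocycleD(1)[OF cocycle, of "Qgen 1" "Lgen (-1)"] D(2,3)
    by (simp add: E_def diag_action_simps n2_cocycleD[OF cocycle])
  have act2: "n2_act (Qgen 2) E = n2_act (Lgen (-1)) F"
    using n2_cocycleD(1)[OF cocycle, of "Qgen 2" "Lgen (-1)"] D(2,3)
    by (simp add: E_def F_def diag_action_simps n2_cocycleD[OF cocycle])
  define u where "u i = coord E (Lgen i) (Hgen (- 1 - i))" for i
  define g where "g i = coord F (Qgen i) (Hgen (2 - i))" for i
  have HH: "coord E (Hgen i) (Hgen j) = 0" for i j
    using arg_cong[OF act0, of "\<lambda>v. coord v (Qgen i) (Hgen j)"] by (simp add: lookup_n2_act)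
  have LH: "coord E (Lgen (i - 1)) (Hgen j) = - 2 * coord E (Qgen i) (Ggen (j - 1))" for i j
    using arg_cong[OF act1, of "\<lambda>v. coord v (Qgen i) (Hgen j)"]
    by (simp add: lookup_n2_act HH algebra_simps eq_neg_iff_add_eq_0)
  have rec: "of_int (i + 1) * g (i + 1) + of_int (2 - i) * g i = 2 * u (i - 1) - 2 * u (i - 2)" for i
  proof -
    have "coord (n2_act (Qgen 2) E) (Qgen i) (Hgen (1 - i)) = 2 * u (i - 2) - 2 * u (i - 1)"
      using LH[of i "- i"] by (simp add: lookup_n2_act HH u_def minus_diff_commute)
    moreover have "coord (n2_act (Lgen (-1)) F) (Qgen i) (Hgen (1 - i))
        = - of_int (i + 1) * g (i + 1) - of_int (2 - i) * g i"
      by (simp add: lookup_n2_act g_def algebra_simps)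
    ultimately show ?thesis using act2 by (simp add: algebra_simps)
  qed
  \<comment> \<open>The requirement is \<open>4 (C (i - 1) - C (i - 2)) = g i\<close>. Summing
    \<open>g\<close> need not give finite support; \<open>rec\<close> allows this closed form in
    coordinates of \<open>E\<close> and \<open>F\<close>, which has it.\<close>
  define C where "C i = (u i - of_int (i + 2) * g (i + 2) / 2) / 4" for i
  have u: "2 * u i = 8 * C i + of_int (i + 2) * g (i + 2)" for i
    by (simp add: C_def field_simps)
  have "2 * (4 * C (i - 1) - 4 * C (i - 2)) = 2 * g i" for i
    using rec[of i] unfolding u by (simp add: algebra_simps)
  then have C: "4 * C (i - 1) - 4 * C (i - 2) = g i" for i
    by (metis mult_cancel_left zero_neq_numeral)
  have F_degree: "coord F (Qgen i) (Hgen j) = 0" if "i + j \<noteq> 2" for i j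
  proof -
    have "n2_degree (Qgen i) + n2_degree (Hgen j) \<noteq> n2_degree (Qgen 2)"
      using that by (auto simp: complex_eq_iff)
    then show ?thesis
      using D(1) unfolding n2_graded_cocycle_def n2_graded_def F_def by blast
  qed
  obtain N1 where N1: "coord F a b \<noteq> 0 \<Longrightarrow> \<bar>n2_index a\<bar> \<le> N1 \<and> \<bar>n2_index b\<bar> \<le> N1" for a b
    using n2_coord_bounded[of F] by blast
  obtain N2 where N2: "coord E a b \<noteq> 0 \<Longrightarrow> \<bar>n2_index a\<bar> \<le> N2 \<and> \<bar>n2_index b\<bar> \<le> N2" for a b
    using n2_coord_bounded[of E] by blast
  \<comment> \<open>The margin absorbs the shift by 2 in \<open>g (i + 2)\<close>.\<close>
  define N where "N = max N1 N2 + 3"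
  have C0: "C i = 0" if "\<bar>i\<bar> \<ge> N" for i
  proof -
    have "u i = 0"
      using N2[of "Lgen i" "Hgen (- 1 - i)"] that unfolding u_def N_def by fastforce
    moreover have "g (i + 2) = 0"
      using N1[of "Qgen (i + 2)" "Hgen (2 - (i + 2))"] that unfolding g_def N_def by fastforce
    ultimately show ?thesis by (simp add: C_def)
  qed
  \<comment> \<open>The coefficients of \<open>R(c)\<close> for \<open>c\<close> the sum of
    \<open>C i\<close> times \<open>x^i y^(-1-i)\<close>.\<close>
  define f where "f a b = (case (a, b) of
        (Lgen i, Lgen j) \<Rightarrow> if i + j = 0 then 2 * C i - 2 * C (i - 1) else 0
      | (Lgen i, Hgen j) \<Rightarrow> if i + j = 0 then - 2 * C i else 0
      | (Hgen i, Lgen j) \<Rightarrow> if i + j = 0 then 2 * C (i - 1) else 0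
      | (Ggen i, Qgen j) \<Rightarrow> if i + j = 0 then C i else 0
      | (Qgen i, Ggen j) \<Rightarrow> if i + j = 0 then C (i - 1) else 0 | _ \<Rightarrow> 0)" for a b
  have "\<bar>n2_index a\<bar> \<le> N + 1 \<and> \<bar>n2_index b\<bar> \<le> N + 1" if "f a b \<noteq> 0" for a b
  proof (rule ccontr)
    assume out: "\<not> (\<bar>n2_index a\<bar> \<le> N + 1 \<and> \<bar>n2_index b\<bar> \<le> N + 1)"
    have "f a b = 0"
      using out by (cases a; cases b) (auto simp: f_def C0)
    with that show False ..
  qed
  then obtain r where r: "coord r a b = f a b" for a b
    using n2_exists_coord[of f "N + 1"] by blast
  have "n2_graded 0 r"
    unfolding n2_graded_def r
  proof (intro allI impI)
    fix a b assume "n2_degree a + n2_degree b \<noteq> 0"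
    then show "f a b = 0" by (cases a; cases b) (auto simp: f_def complex_eq_iff)
  qed
  moreover have "n2_act (Qgen 0) r = 0"
  proof (rule coord_eqI)
    fix a b
    show "coord (n2_act (Qgen 0) r) a b = coord 0 a b"
      by (cases a; cases b) (simp_all add: lookup_n2_act r f_def)
  qed
  moreover have "n2_act (Qgen 1) r = 0"
  proof (rule coord_eqI)
    fix a b
    show "coord (n2_act (Qgen 1) r) a b = coord 0 a b"
      by (cases a; cases b) (auto simp: lookup_n2_act r f_def)
  qed
  moreover have "coord (n2_act (Qgen 2) r) (Qgen i) (Hgen j) = coord (D (basis (Qgen 2))) (Qgen i)
      (Hgen j)" for i j
  proof (cases "i + j = 2")
    case True
    then have j: "j = 2 - i" by simp
    show ?thesis using C[of i] unfolding j by (simp add: lookup_n2_act r f_def g_def F_def)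
  next
    case False
    then show ?thesis using F_degree[of i j] by (auto simp: lookup_n2_act r f_def F_def)
  qed
  ultimately show thesis by (rule that)
qed

text \<open>Vanishing below \<open>N\<close> makes strong induction over the integers well-founded,
  with measure \<open>nat (i - N)\<close>.\<close>

lemma int_vanishing_induct:
  fixes f :: "int \<Rightarrow> complex"
  assumes "\<And>i. i < N \<Longrightarrow> f i = 0" "\<And>i. (\<And>j. j < i \<Longrightarrow> f j = 0) \<Longrightarrow> f i = 0"
  shows "f i = 0"
proof (induction "nat (i - N)" arbitrary: i rule: less_induct)
  case less
  show ?case
  proof (rule assms(2))
    fix j assume "j < i"
    show "f j = 0"
    proof (cases "j < N")
      case False
      with \<open>j < i\<close> show ?thesis by (intro less) auto
    qed (rule assms(1))
  qed
qed

text \<open>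
  For \<open>k\<close> outside \<open>{0, 1, 2}\<close> the fourth operator is needed to exclude the elements killed by
  \<open>Q\<^sub>0\<close>, \<open>Q\<^sub>1\<close> and \<open>Q\<^sub>2\<close>, which are determined by their \<open>Q \<otimes> H\<close> coordinate.
\<close>

lemma n2_Q_kernel:
  assumes v: "n2_graded (n2_degree (Qgen k)) v"
    and kill: "n2_act (Qgen 0) v = 0" "n2_act (Qgen 1) v = 0" "n2_act (Qgen 2) v = 0" "n2_act (Qgen
        k) v = 0"
    and QH: "(\<forall>i j. coord v (Qgen i) (Hgen j) = 0) \<or> k \<notin> {0, 1, 2}"
  shows "v = 0"
proof -
  have g: "coord v a b = 0" if "n2_degree a + n2_degree b \<noteq> - of_int k - \<i>" for a b
    using v that unfolding n2_graded_def by simp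
  define \<alpha> where "\<alpha> i = coord v (Lgen i) (Qgen (k - i))" for i
  define \<beta> where "\<beta> i = coord v (Qgen i) (Lgen (k - i))" for i
  define \<gamma> where "\<gamma> i = coord v (Qgen i) (Hgen (k - i))" for i
  have sym: "coord v (Hgen i) (Qgen j) = coord v (Qgen i) (Hgen j)" for i j
    using arg_cong[OF kill(1), of "\<lambda>v. coord v (Qgen i) (Qgen j)"] by (simp add: lookup_n2_act)
  have eq: "of_int m * \<alpha> (i - m) + \<gamma> (i - m) = of_int m * \<beta> i + \<gamma> i"
    if "n2_act (Qgen m) v = 0" for m i
    using arg_cong[OF that, of "\<lambda>v. coord v (Qgen i) (Qgen (k + m - i))"]
    by (simp add: lookup_n2_act sym \<alpha>_def \<beta>_def \<gamma>_def algebra_simps)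
  obtain N where N: "coord v a b \<noteq> 0 \<Longrightarrow> \<bar>n2_index a\<bar> \<le> N \<and> \<bar>n2_index b\<bar> \<le> N" for a b
    using n2_coord_bounded[of v] by blast
  have small: "\<beta> i = 0" "\<gamma> i = 0" if "i < - N" for i
    using N[of "Qgen i" "Lgen (k - i)"] N[of "Qgen i" "Hgen (k - i)"] that
    unfolding \<beta>_def \<gamma>_def by fastforce+
  have \<alpha>1: "\<alpha> i = \<beta> (i + 1) + \<gamma> (i + 1) - \<gamma> i" for i
    using eq[OF kill(2), of "i + 1"] by (simp add: algebra_simps)
  \<comment> \<open>Inserting the \<open>Q_1\<close> relation into the \<open>Q_2\<close> relation
    shows that \<open>2 * \<beta> i + \<gamma> i - \<gamma> (i - 1)\<close> does not depend on
    \<open>i\<close>; it vanishes for very negative \<open>i\<close>.\<close>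
  have step: "2 * \<beta> i + \<gamma> i - \<gamma> (i - 1) = 2 * \<beta> (i - 1) + \<gamma> (i - 1) - \<gamma> (i - 2)" for i
    using eq[OF kill(3), of i] \<alpha>1[of "i - 2"] by (simp add: algebra_simps)
  have \<beta>: "2 * \<beta> i + \<gamma> i - \<gamma> (i - 1) = 0" for i
  proof (rule int_vanishing_induct[where N = "- N" and f = "\<lambda>i. 2 * \<beta> i + \<gamma> i - \<gamma> (i - 1)"])
    show "2 * \<beta> i + \<gamma> i - \<gamma> (i - 1) = 0" if "i < - N" for i
      using small that by simp
    fix i assume "\<And>j. j < i \<Longrightarrow> 2 * \<beta> j + \<gamma> j - \<gamma> (j - 1) = 0"
    from this[of "i - 1"] show "2 * \<beta> i + \<gamma> i - \<gamma> (i - 1) = 0"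
      using step[of i] by simp
  qed
  have \<gamma>: "\<gamma> i = 0" for i
  proof (cases "k \<in> {0, 1, 2}")
    case True
    then show ?thesis using QH by (auto simp: \<gamma>_def)
  next
    case False
    have \<alpha>: "2 * \<alpha> i = \<gamma> (i + 1) - \<gamma> i" for i
      using \<beta>[of "i + 1"] unfolding \<alpha>1 by (simp add: algebra_simps)
    have \<beta>': "2 * \<beta> i = \<gamma> (i - 1) - \<gamma> i" for i
      using \<beta>[of i] by (simp add: algebra_simps)
    have 2: "of_int k * (2 * \<alpha> (i - k)) + 2 * \<gamma> (i - k) = of_int k * (2 * \<beta> i) + 2 * \<gamma> i" for i
      using arg_cong[OF eq[OF kill(4), of i], of "\<lambda>z. 2 * z"] by (simp add: algebra_simps)
    \<comment> \<open>The relation for \<open>Q_k\<close> with \<alpha> and \<beta> eliminated. It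
      is trivial for \<open>k\<close> in \<open>{0, 1, 2}\<close>; otherwise its term of largest
      index has a nonzero coefficient.\<close>
    have rec: "of_int k * \<gamma> (i - k + 1) + of_int (2 - k) * \<gamma> (i - k)
        = of_int k * \<gamma> (i - 1) + of_int (2 - k) * \<gamma> i" for i
      using 2[of i] unfolding \<alpha> \<beta>' by (simp add: algebra_simps)
    show ?thesis
    proof (rule int_vanishing_induct[where N = "- N" and f = \<gamma>])
      show "\<gamma> i = 0" if "i < - N" for i using small that by simp
      fix i assume IH: "\<And>j. j < i \<Longrightarrow> \<gamma> j = 0"
      show "\<gamma> i = 0"
      proof (cases "k > 0")
        case True
        with False have "k \<ge> 3" by auto
        then have "of_int (2 - k) * \<gamma> i = 0" using rec[of i] by (simp add: IH del: of_int_diff)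
        moreover have "complex_of_int (2 - k) \<noteq> 0"
          using \<open>k \<ge> 3\<close> unfolding of_int_eq_0_iff by simp
        ultimately show ?thesis by simp
      next
        case neg: False
        with False have "k < 0" by auto
        \<comment> \<open>For negative \<open>k\<close> the largest index is
          \<open>i - k + 1\<close>, so the recurrence is shifted to bring it to
          \<open>i\<close>.\<close>
        then have "of_int k * \<gamma> i = 0" using rec[of "i + k - 1"] by (simp add: IH)
        with \<open>k < 0\<close> show ?thesis by simp
      qed
    qed
  qed
  have zero: "\<beta> i = 0" "\<alpha> i = 0" for i
    using \<beta>[of i] \<alpha>1[of i] \<beta>[of "i + 1"] by (simp_all add: \<gamma>)
  have "coord v a b = 0" if "n2_degree a + n2_degree b = - of_int k - \<i>" for a b
  proof -
    have k: "k = n2_index a + n2_index b"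
      using that by (cases a; cases b) (simp_all add: complex_eq_iff flip: of_int_add)
    show ?thesis
      using that zero[of "n2_index a"] \<gamma>[of "n2_index a"] unfolding \<alpha>_def \<beta>_def \<gamma>_def k
      by (cases a; cases b) (simp_all add: complex_eq_iff sym)
  qed
  then have "coord v a b = 0" for a b
    using g[of a b] by blast
  then show ?thesis by (intro coord_eqI) simp
qed

text \<open>If \<open>D\<close> kills all \<open>Q_m\<close> and \<open>[Q_m, x]\<close>, then
  \<open>Q_m\<close> kills \<open>D x\<close>, which is thus supported on
  \<open>Q \<otimes> Q\<close>; the charge -2 there is not that of \<open>x\<close>. The brackets
  \<open>[Q_m, x]\<close> allow the order H, L, G.\<close>

lemma n2_graded_cocycle_eq_0:
  assumes D: "n2_graded_cocycle D" "\<And>m. D (basis (Qgen m)) = 0"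
  shows "D x = 0"
proof -
  have cocycle: "n2_cocycle D" using D by (simp add: n2_graded_cocycle_def)
  have not_QQ: "D (basis x) = 0" if kill: "\<And>m. D (n2_basis_bracket (Qgen m) x) = 0" and x: "\<And>i. x \<noteq>
      Qgen i" for x
  proof (rule coord_eqI)
    fix a b
    have "n2_act (Qgen m) (D (basis x)) = 0" for m
      using n2_cocycleD(1)[OF cocycle, of "Qgen m" x] kill[of m] D(2) by (simp add: diag_action_simps)
    then have "coord (D (basis x)) a b = 0" if "(\<forall>i. a \<noteq> Qgen i) \<or> (\<forall>i. b \<noteq> Qgen i)"
      using that by (rule n2_act_Q_kernel)
    moreover have "coord (D (basis x)) (Qgen i) (Qgen j) = 0" for i j
    proof -
      have "n2_degree (Qgen i) + n2_degree (Qgen j) \<noteq> n2_degree x"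
        using x by (cases x) (auto simp: complex_eq_iff)
      then show ?thesis using D(1) unfolding n2_graded_cocycle_def n2_graded_def by blast
    qed
    ultimately show "coord (D (basis x)) a b = coord 0 a b"
      by (cases a; cases b) auto
  qed
  have H: "D (basis (Hgen n)) = 0" for n
    by (rule not_QQ) (simp_all add: D(2))
  have L: "D (basis (Lgen n)) = 0" for n
    by (rule not_QQ) (simp_all add: D(2) n2_cocycleD[OF cocycle])
  have G: "D (basis (Ggen n)) = 0" for n
  proof (rule not_QQ)
    fix m
    have "D (n2_basis_bracket (Qgen m) (Ggen n))
        = D (scale 2 (basis (Lgen (m + n))) + scale (- 2 * of_int m) (basis (Hgen (m + n))))"
      by (simp add: cvec.scale_minus_left)
    also have "\<dots> = 0" unfolding n2_cocycleD[OF cocycle] by (simp add: L H)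
    finally show "D (n2_basis_bracket (Qgen m) (Ggen n)) = 0" .
  qed simp
  have "D (basis a) = 0" for a using H L G D(2) by (cases a) simp_all
  then show ?thesis
    by (intro cvec_induct[of "\<lambda>x. D x = 0" x]) (simp_all add: n2_cocycleD[OF cocycle])
qed

text \<open>After grading, the corrections have degree zero and so keep the grading, and each is
  killed by the generators \<open>Q_m\<close> treated before.\<close>

lemma n2_cocycle_is_coboundary:
  assumes D: "n2_cocycle D" and even: "\<And>x. n2_parity x = 0 \<Longrightarrow> D (basis x) \<in> homogeneous (parity2
      n2_parity) 0"
  obtains r where "r \<in> homogeneous (parity2 n2_parity) 0" "D = (\<lambda>x. diag_action n2_parity n2_bracket
      x r)"
proof -
  let ?d = "\<lambda>r x. diag_action n2_parity n2_bracket x r"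
  obtain r1 where r1: "r1 \<in> homogeneous (parity2 n2_parity) 0" "n2_graded_cocycle (\<lambda>x. D x - ?d r1 x)"
    using D even by (rule n2_cocycle_make_graded)
  define D1 where "D1 = (\<lambda>x. D x - ?d r1 x)"
  have D1: "n2_graded_cocycle D1" using r1 by (simp add: D1_def)
  obtain r2 where r2: "n2_graded 0 r2" "?d r2 (basis (Qgen 0)) = D1 (basis (Qgen 0))"
    using D1 by (rule n2_kill_Q0)
  define D2 where "D2 = (\<lambda>x. D1 x - ?d r2 x)"
  have D2: "n2_graded_cocycle D2" "D2 (basis (Qgen 0)) = 0"
    using n2_graded_cocycle_diff[OF D1 r2(1)] r2(2) by (simp_all add: D2_def)
  obtain r3 where r3: "n2_graded 0 r3" "?d r3 (basis (Qgen 0)) = 0"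
      "?d r3 (basis (Qgen 1)) = D2 (basis (Qgen 1))"
    using D2 by (rule n2_kill_Q1)
  define D3 where "D3 = (\<lambda>x. D2 x - ?d r3 x)"
  have D3: "n2_graded_cocycle D3" "D3 (basis (Qgen 0)) = 0" "D3 (basis (Qgen 1)) = 0"
    using n2_graded_cocycle_diff[OF D2(1) r3(1)] r3(2,3) D2(2) by (simp_all add: D3_def)
  obtain r4 where r4: "n2_graded 0 r4" "?d r4 (basis (Qgen 0)) = 0" "?d r4 (basis (Qgen 1)) = 0"
      "\<And>i j. coord (?d r4 (basis (Qgen 2))) (Qgen i) (Hgen j) = coord (D3 (basis (Qgen 2))) (Qgen i)
          (Hgen j)"
    using n2_kill_Q2[OF D3] by blast
  define D4 where "D4 = (\<lambda>x. D3 x - ?d r4 x)"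
  have D4: "n2_graded_cocycle D4" "D4 (basis (Qgen 0)) = 0" "D4 (basis (Qgen 1)) = 0"
      "coord (D4 (basis (Qgen 2))) (Qgen i) (Hgen j) = 0" for i j
    using n2_graded_cocycle_diff[OF D3(1) r4(1)] r4(2,3,4) D3(2,3) by (simp_all add: D4_def lookup_minus)
  have cocycle: "n2_cocycle D4" and degree: "n2_graded (n2_degree (Qgen k)) (D4 (basis (Qgen k)))" for k
    using D4(1) unfolding n2_graded_cocycle_def by blast+
  have square: "n2_act (Qgen k) (D4 (basis (Qgen k))) = 0" for k
    using cocycle by (rule n2_act_Q_square)
  have kill: "n2_act (Qgen m) (D4 (basis (Qgen k))) = 0" if "D4 (basis (Qgen m)) = 0" for k m
    using n2_cocycle_QQ[OF cocycle, of m k] that by (simp add: diag_action_simps)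
  \<comment> \<open>Here \<open>k = 2\<close>, so the third and fourth operators coincide; the
    \<open>Q \<otimes> H\<close> coordinates vanish by the choice of \<open>r4\<close>.\<close>
  have Q2: "D4 (basis (Qgen 2)) = 0"
    by (rule n2_Q_kernel[OF degree kill kill square square]) (use D4 in auto)
  have "D4 (basis (Qgen k)) = 0" for k
  proof (cases "k \<in> {0, 1, 2}")
    case True
    then show ?thesis using D4 Q2 by auto
  next
    case False
    show ?thesis
      by (rule n2_Q_kernel[OF degree kill kill kill square]) (use D4 Q2 False in auto)
  qed
  then have "D4 x = 0" for x
    by (rule n2_graded_cocycle_eq_0[OF D4(1)])
  then have "D x = ?d (r1 + r2 + r3 + r4) x" for x
    unfolding D4_def D3_def D2_def D1_def by (simp only: diag_action_simps diff_diff_eq right_minus_eq)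
  moreover have "r1 + r2 + r3 + r4 \<in> homogeneous (parity2 n2_parity) 0"
    by (intro homogeneous_closed r1 n2_graded_0_even r2 r3 r4)
  ultimately show thesis by (intro that) auto
qed

section \<open>Lie super-bialgebra structures\<close>

theorem theorem1p1:
  fixes \<Delta> :: "n2_basis cvec \<Rightarrow> (n2_basis \<times> n2_basis) cvec"
  assumes "lie_superbialgebra n2_parity n2_bracket \<Delta>"
  shows "\<exists>r k. r \<in> homogeneous (parity2 n2_parity) k \<and>
    r \<in> im_one_minus_twist n2_parity \<and>
    \<Delta> = coboundary n2_parity n2_bracket r \<and>
    satisfies_cybe n2_parity n2_bracket r"
proof -
  have coalgebra: "linear_map \<Delta>" "\<And>i. \<Delta> ` homogeneous n2_parity i \<subseteq> homogeneous (parity2 n2_parity) i"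
      "range \<Delta> \<subseteq> im_one_minus_twist n2_parity"
      "\<And>x. id_tensor \<Delta> (\<Delta> x) + super_cyclic n2_parity (id_tensor \<Delta> (\<Delta> x))
        + super_cyclic n2_parity (super_cyclic n2_parity (id_tensor \<Delta> (\<Delta> x))) = 0"
    using assms unfolding lie_superbialgebra_def lie_supercoalgebra_def Let_def by blast+
  have compat: "\<Delta> (n2_bracket x y) = diag_action n2_parity n2_bracket x (\<Delta> y)
      - scale (ksign (i * j)) (diag_action n2_parity n2_bracket y (\<Delta> x))"
    if "x \<in> homogeneous n2_parity i" "y \<in> homogeneous n2_parity j" for x y i j
    using assms that unfolding lie_superbialgebra_def by blast
  have "n2_cocycle \<Delta>"
    unfolding n2_cocycle_def
    using coalgebra(1) compat[OF n2.basis_homogeneous n2.basis_homogeneous] by simp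
  moreover have "\<Delta> (basis x) \<in> homogeneous (parity2 n2_parity) 0" if "n2_parity x = 0" for x
    using coalgebra(2)[of 0] n2.basis_homogeneous[of x] that by auto
  ultimately obtain r where r: "r \<in> homogeneous (parity2 n2_parity) 0"
    and \<Delta>: "\<Delta> = (\<lambda>x. diag_action n2_parity n2_bracket x r)"
    by (rule n2_cocycle_is_coboundary)
  have "n2_act x (r + super_twist n2_parity r) = 0" for x
  proof -
    \<comment> \<open>The image of \<open>\<Delta>\<close> lies in the (-1)-eigenspace of \<tau>,
      and \<tau> commutes with the action.\<close>
    have "super_twist n2_parity (n2_act x r) = - n2_act x r"
      using coalgebra(3) unfolding \<Delta> im_one_minus_twist_iff[symmetric] by blast
    then show ?thesis
      by (simp add: diag_action_simps n2.super_twist_act[OF n2.basis_homogeneous, symmetric])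
  qed
  then have "r + super_twist n2_parity r = 0" by (rule n2_act_invariant)
  then have skew: "super_twist n2_parity r = - r" by (simp add: eq_neg_iff_add_eq_0 add.commute)
  \<comment> \<open>The co-Jacobi identity at the basis vector \<open>x\<close> is exactly
    \<open>x \<cdot> c(r) = 0\<close>.\<close>
  have "diag_action3 n2_parity n2_bracket x (yang_baxter n2_parity n2_bracket r) = 0" for x
    using n2.co_jacobi_eq_action_yang_baxter[OF r skew refl, of x] coalgebra(4)[of "basis x"]
    unfolding \<Delta> by simp
  then have "yang_baxter n2_parity n2_bracket r = 0" by (rule n2_act3_invariant)
  then have "satisfies_cybe n2_parity n2_bracket r"
    using n2.cybe_elem_eq_yang_baxter[OF r] by (simp add: satisfies_cybe_def extend_simps)
  moreover have "\<Delta> = coboundary n2_parity n2_bracket r"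
    unfolding \<Delta> coboundary_even[OF r] ..
  moreover have "r \<in> im_one_minus_twist n2_parity"
    using skew by (simp add: im_one_minus_twist_iff)
  ultimately show ?thesis using r by blast
qed

end
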